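(* Let $\mathcal{H}_q$ be the $3$-uniform hypergraph whose vertices are the points of $\mathrm{PG}(3,q)$ and whose hyperedges are the collinear triples. There is an absolute constant $c>0$ such that for all $0<\gamma\leq 1/10$ and all sufficiently large $q$ there is a family $\mathcal{C}$ of subsets of $V(\mathcal{H}_q)$ with: (1) every cap $I$ of $\mathrm{PG}(3,q)$ is contained in some $C\in\mathcal{C}$; (2) $|C|\leq (1+\gamma)\begin{bmatrix} 3\\1\end{bmatrix}_q$ for all $C\in\mathcal{C}$; (3) $\ln|\mathcal{C}|\leq cq\ln^2 q+c\gamma^{-1}q\ln q$.
   Context: A cap in $\mathrm{PG}(3,q)$ is a set of points no three of which are collinear. $\begin{bmatrix} 3\\1\end{bmatrix}_q=q^2+q+1$. *)

theory Defs
  imports Complex_Main "HOL-Library.FuncSet" "HOL-Algebra.Weak_Morphisms"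
begin

(* Finite fields are HOL-Algebra structures rather than types of class field, because the order q
   is quantified inside the theorem (a constant c that is uniform over all fields). Vectors of F^n
   are the extensional functions from {..<n} to the carrier. *)

definition vectors :: "('a, 'm) ring_scheme \<Rightarrow> nat \<Rightarrow> (nat \<Rightarrow> 'a) set" where
  "vectors F n = {..<n} \<rightarrow>\<^sub>E carrier F"

definition zero_vector :: "('a, 'm) ring_scheme \<Rightarrow> nat \<Rightarrow> nat \<Rightarrow> 'a" where
  "zero_vector F n = (\<lambda>i\<in>{..<n}. \<zero>\<^bsub>F\<^esub>)"

definition lin_comb ::
  "('a, 'm) ring_scheme \<Rightarrow> nat \<Rightarrow> nat \<Rightarrow> (nat \<Rightarrow> 'a) \<Rightarrow> (nat \<Rightarrow> nat \<Rightarrow> 'a) \<Rightarrow> nat \<Rightarrow> 'a" where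
  "lin_comb F n k a v = (\<lambda>i\<in>{..<n}. \<Oplus>\<^bsub>F\<^esub>j\<in>{..<k}. a j \<otimes>\<^bsub>F\<^esub> v j i)"

definition lin_span ::
  "('a, 'm) ring_scheme \<Rightarrow> nat \<Rightarrow> nat \<Rightarrow> (nat \<Rightarrow> nat \<Rightarrow> 'a) \<Rightarrow> (nat \<Rightarrow> 'a) set" where
  "lin_span F n k v = {lin_comb F n k a v |a. a \<in> {..<k} \<rightarrow> carrier F}"

definition lin_indep ::
  "('a, 'm) ring_scheme \<Rightarrow> nat \<Rightarrow> nat \<Rightarrow> (nat \<Rightarrow> nat \<Rightarrow> 'a) \<Rightarrow> bool" where
  "lin_indep F n k v \<longleftrightarrow>
    (\<forall>a \<in> {..<k} \<rightarrow> carrier F. lin_comb F n k a v = zero_vector F n \<longrightarrow> (\<forall>j<k. a j = \<zero>\<^bsub>F\<^esub>))"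

(* The k-dimensional subspaces of F^n: those having a basis v 0, ..., v (k - 1). *)
definition subspaces_dim ::
  "('a, 'm) ring_scheme \<Rightarrow> nat \<Rightarrow> nat \<Rightarrow> (nat \<Rightarrow> 'a) set set" where
  "subspaces_dim F n k =
    {lin_span F n k v |v. v \<in> {..<k} \<rightarrow> vectors F n \<and> lin_indep F n k v}"

definition PG3_points :: "('a, 'm) ring_scheme \<Rightarrow> (nat \<Rightarrow> 'a) set set" where
  "PG3_points F = subspaces_dim F 4 1"

definition PG3_lines :: "('a, 'm) ring_scheme \<Rightarrow> (nat \<Rightarrow> 'a) set set" where
  "PG3_lines F = subspaces_dim F 4 2"

(* A point P lies on a line L iff P \<subseteq> L as subspaces of F^4. *)
definition PG3_collinear :: "('a, 'm) ring_scheme \<Rightarrow> (nat \<Rightarrow> 'a) set set \<Rightarrow> bool" where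
  "PG3_collinear F S \<longleftrightarrow> (\<exists>L \<in> PG3_lines F. \<forall>P \<in> S. P \<subseteq> L)"

(* The pair (vertex set, set of hyperedges). *)
definition PG3_hypergraph ::
  "('a, 'm) ring_scheme \<Rightarrow> (nat \<Rightarrow> 'a) set set \<times> (nat \<Rightarrow> 'a) set set set" where
  "PG3_hypergraph F =
    (PG3_points F, {T. T \<subseteq> PG3_points F \<and> card T = 3 \<and> PG3_collinear F T})"

definition PG3_cap :: "('a, 'm) ring_scheme \<Rightarrow> (nat \<Rightarrow> 'a) set set \<Rightarrow> bool" where
  "PG3_cap F I \<longleftrightarrow> I \<subseteq> PG3_points F \<and> \<not> (\<exists>T \<subseteq> I. card T = 3 \<and> PG3_collinear F T)"

(* The theorem quantifies over fields whose carrier is a set of natural numbers;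
   up to isomorphism these include all finite fields. *)
lemma finite_field_iso_nat_field:
  fixes F :: "('a, 'm) ring_scheme"
  assumes F: "field F" and fin: "finite (carrier F)"
  shows "\<exists>(G :: nat ring) f. field G \<and> finite (carrier G) \<and> order G = order F \<and> f \<in> ring_iso F G"
proof -
  interpret field F by (rule F)
  obtain f :: "'a \<Rightarrow> nat" where f: "inj_on f (carrier F)"
    using finite_imp_inj_to_nat_seg[OF fin] by blast
  show ?thesis
    using inj_imp_image_ring_is_field[OF f] inj_imp_image_ring_iso[OF f] fin card_image[OF f]
    by (auto simp: order_def image_ring_carrier intro!: exI[of _ "image_ring f F"] exI[of _ f])
qed

end

theory Submission
  imports Defs "HOL-Analysis.Convex" "HOL-Algebra.Module" "HOL-Algebra.Multiplicative_Group"
begin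

text \<open>Put \<open>m = q\<^sup>2 + q + 1\<close>, the number of lines through a point. Reveal a cap one point at a time: if \<open>A\<close> is
  the revealed part, the rest of the cap lies in the set \<open>S\<close> of points off the secants of \<open>A\<close>. Each
  \<open>a \<in> A\<close> has \<open>|A| - 1\<close> secants, which miss \<open>S\<close>, so its other lines split \<open>S\<close> into at most
  \<open>m + 1 - |A|\<close> classes of mutually exclusive points. By convexity some point of \<open>S\<close> excludes at least
  \<open>|A| (e - 1) / m\<close> others, where \<open>e = |A| + |S| - m\<close>. Once \<open>|A| \<ge> q\<close>, each revealed point therefore
  shrinks \<open>e - 1\<close> by the factor \<open>1 - q / m\<close>, and \<open>O(q ln q)\<close> revealed points confine the cap to
  \<open>m + 1\<close> points. Since no cap has more than \<open>m\<close> points, one more point can be removed. The resulting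
  containers have size \<open>m\<close>, independently of \<open>\<gamma>\<close>, and their number is \<open>exp (O(q ln\<^sup>2 q))\<close>.\<close>

section \<open>Caps in projective spaces of dimension three\<close>

text \<open>The last axiom is Veblen's: a line that meets the sides \<open>M1\<close> and
  \<open>M2\<close> of a triangle, but misses their common vertex \<open>Q\<close>, also meets the
  third side. It stands in for planes, and the number of points fixes the dimension.\<close>

locale projective_space =
  fixes points :: "'p set" and lines :: "'p set set" and q :: nat
  assumes order_pos: "q > 0"
    and line_subset: "L \<in> lines \<Longrightarrow> L \<subseteq> points"
    and card_line: "L \<in> lines \<Longrightarrow> card L = q + 1"
    and card_points: "card points = q^3 + q^2 + q + 1"
    and line_exists: "P \<in> points \<Longrightarrow> Q \<in> points \<Longrightarrow> P \<noteq> Q \<Longrightarrow> \<exists>L\<in>lines. P \<in> L \<and> Q \<in> L"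
    and line_unique: "L \<in> lines \<Longrightarrow> L' \<in> lines \<Longrightarrow> P \<noteq> Q \<Longrightarrow> P \<in> L \<Longrightarrow> Q \<in> L
      \<Longrightarrow> P \<in> L' \<Longrightarrow> Q \<in> L' \<Longrightarrow> L = L'"
    and veblen: "\<lbrakk>L \<in> lines; M1 \<in> lines; M2 \<in> lines; M3 \<in> lines; P \<noteq> Q; Q \<noteq> R; P \<noteq> R;
      P \<in> M1; Q \<in> M1; Q \<in> M2; R \<in> M2; P \<in> M3; R \<in> M3; Q \<notin> L; L \<inter> M1 \<noteq> {}; L \<inter> M2 \<noteq> {}\<rbrakk>
      \<Longrightarrow> L \<inter> M3 \<noteq> {}"
begin

lemma finite_points: "finite points"
  using card_points by (intro card_ge_0_finite) simp

lemma finite_line: "L \<in> lines \<Longrightarrow> finite L"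
  using line_subset finite_points finite_subset by metis

lemma finite_lines: "finite lines"
  using line_subset finite_points by (intro finite_subset[of lines "Pow points"]) auto

section \<open>Counting along the lines through a point\<close>

definition star :: "'p \<Rightarrow> 'p set set" where
  "star P = {L \<in> lines. P \<in> L}"

definition join :: "'p \<Rightarrow> 'p \<Rightarrow> 'p set" where
  "join P Q = (SOME L. L \<in> lines \<and> P \<in> L \<and> Q \<in> L)"

definition cap :: "'p set \<Rightarrow> bool" where
  "cap I \<longleftrightarrow> I \<subseteq> points \<and> (\<forall>L\<in>lines. card (L \<inter> I) \<le> 2)"

lemma finite_star: "finite (star P)"
  using finite_lines by (simp add: star_def)

lemma join:
  assumes "P \<in> points" "Q \<in> points" "P \<noteq> Q"
  shows "join P Q \<in> lines" "P \<in> join P Q" "Q \<in> join P Q"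
  using someI_ex[of "\<lambda>L. L \<in> lines \<and> P \<in> L \<and> Q \<in> L"] line_exists[OF assms]
  by (auto simp: join_def)

lemma join_eq:
  assumes "L \<in> lines" "P \<in> L" "Q \<in> L" "P \<noteq> Q"
  shows "join P Q = L"
proof -
  have "P \<in> points" "Q \<in> points" using assms line_subset by auto
  from join[OF this assms(4)] show ?thesis
    using line_unique[OF _ assms(1,4)] assms(2,3) by simp
qed

text \<open>The lines through \<open>P\<close> partition the remaining points, so counting
  \<open>S\<close> along the star of \<open>P\<close> loses nothing.\<close>

lemma sum_card_star:
  assumes P: "P \<in> points" and S: "S \<subseteq> points" "P \<notin> S"
  shows "(\<Sum>L\<in>star P. card (L \<inter> S)) = card S"
proof -
  have "\<exists>L\<in>star P. x \<in> L" if "x \<in> S" for x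
    using join[OF P, of x] S that by (auto simp: star_def)
  then have "S = (\<Union>L\<in>star P. L \<inter> S)" by auto
  moreover have "card (\<Union>L\<in>star P. L \<inter> S) = (\<Sum>L\<in>star P. card (L \<inter> S))"
  proof (rule card_UN_disjoint[OF finite_star])
    show "\<forall>L\<in>star P. finite (L \<inter> S)"
      using finite_line by (simp add: star_def)
    show "\<forall>L\<in>star P. \<forall>L'\<in>star P. L \<noteq> L' \<longrightarrow> L \<inter> S \<inter> (L' \<inter> S) = {}"
      using line_unique[of _ _ P] S by (fastforce simp: star_def)
  qed
  ultimately show ?thesis by simp
qed

text \<open>Each line of the star carries \<open>q\<close> points besides \<open>P\<close>, and
  together they exhaust the other \<open>q^3 + q^2 + q\<close> points.\<close>

lemma card_star:
  assumes P: "P \<in> points"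
  shows "card (star P) = q^2 + q + 1"
proof -
  have "card (L \<inter> (points - {P})) = q" if "L \<in> star P" for L
  proof -
    have L: "L \<in> lines" "P \<in> L" using that by (auto simp: star_def)
    then have "L \<inter> (points - {P}) = L - {P}"
      using line_subset[of L] by auto
    then show ?thesis
      using L card_line[of L] finite_line[of L] by simp
  qed
  then have "(\<Sum>L\<in>star P. card (L \<inter> (points - {P}))) = (\<Sum>L\<in>star P. q)"
    by (intro sum.cong) auto
  then have "card (star P) * q = card (points - {P})"
    using sum_card_star[OF P, of "points - {P}"] by simp
  also have "\<dots> = q^3 + q^2 + q"
    using P card_points finite_points by simp
  also have "\<dots> = (q^2 + q + 1) * q"
    by (simp add: power2_eq_square power3_eq_cube distrib_right)
  finally show ?thesis using order_pos by (metis mult_cancel2 not_less0)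
qed

lemma cap_unique:
  assumes "cap I" "L \<in> lines" "x \<in> I" "y \<in> I" "z \<in> I" "x \<in> L" "y \<in> L" "z \<in> L" "x \<noteq> y" "x \<noteq> z"
  shows "y = z"
proof (rule ccontr)
  assume "y \<noteq> z"
  then have "card {x,y,z} = 3" using assms by simp
  moreover have "card {x,y,z} \<le> card (L \<inter> I)"
    using assms finite_line by (intro card_mono) auto
  moreover have "card (L \<inter> I) \<le> 2" using assms(1,2) by (simp add: cap_def)
  ultimately show False by simp
qed

text \<open>Passes from caps given by forbidden collinear triples to the bound on line intersections
  that is used for counting.\<close>

lemma capI:
  assumes "I \<subseteq> points" "\<And>L T. L \<in> lines \<Longrightarrow> T \<subseteq> L \<Longrightarrow> T \<subseteq> I \<Longrightarrow> card T = 3 \<Longrightarrow> False"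
  shows "cap I"
  unfolding cap_def
proof (intro conjI ballI)
  fix L assume L: "L \<in> lines"
  show "card (L \<inter> I) \<le> 2"
  proof (rule ccontr)
    assume "\<not> ?thesis"
    then have "3 \<le> card (L \<inter> I)" by simp
    then obtain T where "T \<subseteq> L \<inter> I" "card T = 3" by (meson obtain_subset_with_card_n)
    then show False using assms(2)[OF L, of T] by simp
  qed
qed (rule assms(1))

text \<open>A cap of size \<open>q\<^sup>2 + q + 2\<close> would meet every line in 0 or 2 points. It then has an external line,
  and every plane through that line meets it in 0 or \<open>q + 2\<close> points, so \<open>q + 2\<close> divides 4.\<close>

lemma card_cap_le:
  assumes I: "cap I" and q: "q \<ge> 3"
  shows "card I \<le> q^2 + q + 1"
proof (rule ccontr)
  assume "\<not> ?thesis"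
  then have big: "card I \<ge> q^2 + q + 2" by simp
  have sub: "I \<subseteq> points" and fin: "finite I"
    using I finite_points finite_subset by (auto simp: cap_def)
  have le1: "card (L \<inter> (I - {P})) \<le> 1" if "P \<in> I" "L \<in> star P" for P L
  proof -
    have "L \<inter> (I - {P}) = L \<inter> I - {P}" by auto
    then have "card (L \<inter> (I - {P})) = card (L \<inter> I) - 1"
      using that fin by (simp add: star_def)
    then show ?thesis using I that unfolding cap_def star_def by fastforce
  qed
  have sum: "(\<Sum>L\<in>star P. card (L \<inter> (I - {P}))) = card I - 1" if "P \<in> I" for P
    using sum_card_star[of P "I - {P}"] that sub fin by auto
  \<comment> \<open>The star of a cap point has \<open>q^2 + q + 1\<close> lines with at most one
    further cap point each, so the assumed size is the largest conceivable.\<close>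
  have cardI: "card I = q^2 + q + 2"
  proof -
    obtain P where P: "P \<in> I" using big by fastforce
    have "card I - 1 \<le> card (star P)"
      using sum_mono[of "star P" "\<lambda>L. card (L \<inter> (I - {P}))" "\<lambda>_. 1"] le1[OF P] sum[OF P] by simp
    then show ?thesis using card_star P sub big by auto
  qed
  \<comment> \<open>The count is now tight, so no line of the star may miss the rest of the
    cap.\<close>
  have eq1: "card (L \<inter> (I - {P})) = 1" if P: "P \<in> I" and L: "L \<in> star P" for P L
  proof (rule ccontr)
    assume "\<not> ?thesis"
    then have "card (L \<inter> (I - {P})) < 1" using le1[OF P L] by linarith
    then have "(\<Sum>L\<in>star P. card (L \<inter> (I - {P}))) < (\<Sum>L\<in>star P. 1)"
      using le1[OF P] L finite_star by (intro sum_strict_mono_ex1) auto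
    then show False using sum[OF P] card_star P sub cardI by auto
  qed
  have eq2: "card (L \<inter> I) = 2" if L: "L \<in> lines" "L \<inter> I \<noteq> {}" for L
  proof -
    obtain P where P: "P \<in> I" "P \<in> L" using L by auto
    have "L \<inter> (I - {P}) = L \<inter> I - {P}" by auto
    then have "card (L \<inter> I) - 1 = 1" using eq1[of P L] P fin L by (simp add: star_def)
    then show ?thesis by simp
  qed
  \<comment> \<open>Through a point \<open>Q\<close> off the cap, lines that all met it in two
    points would account for \<open>2 * (q^2 + q + 1)\<close> points, too many.\<close>
  obtain L where L: "L \<in> lines" "L \<inter> I = {}"
  proof -
    have "card I < card points"
      unfolding cardI card_points using q one_less_power[of q 3] by simp
    then have "\<not> points \<subseteq> I"
      using card_mono[OF fin, of points] by linarith
    then obtain Q where Q: "Q \<in> points" "Q \<notin> I"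
      by auto
    have "\<exists>L\<in>star Q. L \<inter> I = {}"
    proof (rule ccontr)
      assume "\<not> ?thesis"
      then have "(\<Sum>L\<in>star Q. card (L \<inter> I)) = (\<Sum>L\<in>star Q. 2)"
        using eq2 by (intro sum.cong) (auto simp: star_def)
      then have "card I = 2 * (q^2 + q + 1)"
        using sum_card_star[of Q I] Q sub card_star by simp
      then show False using cardI q by simp
    qed
    then show ?thesis using that by (auto simp: star_def)
  qed
  \<comment> \<open>The classes of \<open>r\<close> are the sections of \<open>I\<close> by the
    planes through \<open>L\<close>: two points off \<open>L\<close> lie in a common plane with
    \<open>L\<close> exactly when their join meets \<open>L\<close>.\<close>
  define r where "r = {(P, R). P \<in> I \<and> R \<in> I \<and> (P = R \<or> (\<exists>M\<in>lines. P \<in> M \<and> R \<in> M \<and> L \<inter> M \<noteq> {}))}"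
  have eqv: "equiv I r"
  proof (rule equivI)
    show "r \<subseteq> I \<times> I" by (auto simp: r_def)
    show "refl_on I r" by (auto simp: refl_on_def r_def)
    show "sym r" by (auto simp: sym_def r_def)
    show "trans r"
    proof (rule transI)
      fix x y z assume xy: "(x, y) \<in> r" and yz: "(y, z) \<in> r"
      show "(x, z) \<in> r"
      proof (cases "x = y \<or> y = z \<or> x = z")
        case True
        then show ?thesis using xy yz by (auto simp: r_def)
      next
        case False
        then obtain M1 M2 where M: "M1 \<in> lines" "x \<in> M1" "y \<in> M1" "L \<inter> M1 \<noteq> {}"
          "M2 \<in> lines" "y \<in> M2" "z \<in> M2" "L \<inter> M2 \<noteq> {}" and I: "x \<in> I" "y \<in> I" "z \<in> I"
          using xy yz by (auto simp: r_def)
        have xz: "x \<in> points" "z \<in> points" "x \<noteq> z" using I sub False by auto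
        \<comment> \<open>Transitivity is Veblen's axiom for the triangle \<open>x\<close>,
          \<open>y\<close>, \<open>z\<close>, whose vertex \<open>y\<close> is off
          \<open>L\<close>.\<close>
        have "L \<inter> join x z \<noteq> {}"
          using veblen[OF L(1) M(1,5) join(1)[OF xz] _ _ xz(3) M(2,3,6,7) join(2,3)[OF xz] _ M(4,8)] I L False by auto
        then show ?thesis using I join[OF xz] by (auto simp: r_def)
      qed
    qed
  qed
  have cls: "card X = q + 2" if X: "X \<in> I // r" for X
  proof -
    obtain P where P: "P \<in> I" "X = r `` {P}" using X by (auto elim: quotientE)
    have PL: "P \<notin> L" and Pp: "P \<in> points" using P L sub by auto
    have jn: "join P x \<in> lines" "P \<in> join P x" "x \<in> join P x" "join P x \<in> star P" if "x \<in> L" for x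
      using join[of P x] that L line_subset PL Pp by (auto simp: star_def)
    have X_eq: "X - {P} = (\<Union>x\<in>L. join P x \<inter> (I - {P}))"
    proof -
      have 1: "\<exists>x\<in>L. R \<in> join P x" if "R \<in> X" "R \<noteq> P" for R
      proof -
        obtain M where M: "M \<in> lines" "P \<in> M" "R \<in> M" "L \<inter> M \<noteq> {}"
          using \<open>R \<in> X\<close> \<open>R \<noteq> P\<close> P by (auto simp: r_def)
        then obtain x where "x \<in> L" "x \<in> M" by auto
        then have "join P x = M" using join_eq M PL by metis
        then show ?thesis using \<open>x \<in> L\<close> M by auto
      qed
      have 2: "R \<in> X" if "x \<in> L" "R \<in> join P x" "R \<in> I" for x R
        using jn[OF \<open>x \<in> L\<close>] that P by (auto simp: r_def)
      have 3: "X \<subseteq> I" using P by (auto simp: r_def)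
      show ?thesis
      proof (intro equalityI subsetI)
        fix R assume "R \<in> X - {P}"
        then show "R \<in> (\<Union>x\<in>L. join P x \<inter> (I - {P}))" using 1[of R] 3 by auto
      next
        fix R assume "R \<in> (\<Union>x\<in>L. join P x \<inter> (I - {P}))"
        then show "R \<in> X - {P}" using 2 by auto
      qed
    qed
    \<comment> \<open>There is one further cap point on each of the \<open>q + 1\<close> lines from
      \<open>P\<close> to \<open>L\<close>; with \<open>P\<close> itself the class has
      \<open>q + 2\<close>.\<close>
    have "card (X - {P}) = (\<Sum>x\<in>L. card (join P x \<inter> (I - {P})))"
      unfolding X_eq
    proof (rule card_UN_disjoint)
      show "finite L" using L finite_line by auto
      show "\<forall>x\<in>L. finite (join P x \<inter> (I - {P}))" using fin by auto
      show "\<forall>x\<in>L. \<forall>y\<in>L. x \<noteq> y \<longrightarrow> join P x \<inter> (I - {P}) \<inter> (join P y \<inter> (I - {P})) = {}"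
      proof (intro ballI impI)
        fix x y assume xy: "x \<in> L" "y \<in> L" "x \<noteq> y"
        show "join P x \<inter> (I - {P}) \<inter> (join P y \<inter> (I - {P})) = {}"
        proof (rule ccontr)
          assume "\<not> ?thesis"
          then obtain R where "R \<in> join P x" "R \<in> join P y" "R \<noteq> P" by auto
          then have "join P x = join P y"
            using line_unique[of "join P x" "join P y" P R] jn(1,2) xy by auto
          then have "join P x = L" using line_unique[of "join P x" L x y] jn xy L by auto
          then show False using jn xy PL by auto
        qed
      qed
    qed
    also have "\<dots> = q + 1" using eq1[OF P(1)] jn card_line L by simp
    finally have "card (X - {P}) = q + 1" .
    moreover have "P \<in> X" "finite X" using P fin finite_subset[of X I] by (auto simp: r_def)
    ultimately show ?thesis by simp
  qed
  have "(q + 2) dvd card I"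
    using cls by (intro equiv_imp_dvd_card[OF fin eqv]) auto
  moreover have "card I = 4 + (q + 2) * (q - 1)"
  proof -
    obtain k where "q = Suc k" using order_pos gr0_implies_Suc by blast
    then show ?thesis unfolding cardI by (simp add: power2_eq_square)
  qed
  ultimately have "(q + 2) dvd 4"
    by (metis dvd_add_left_iff dvd_triv_left)
  \<comment> \<open>This is where \<open>q = 2\<close> must be excluded: there the complement of a
    plane is a cap of \<open>q^2 + q + 2\<close> points.\<close>
  then have "q + 2 \<le> 4" by (rule dvd_imp_le) simp
  then show False using q by simp
qed

section \<open>Containers\<close>

text \<open>\<open>A\<close> is the part of an unknown cap that has been revealed, and \<open>S\<close> holds the other points that
  the cap may still contain, so \<open>S\<close> avoids the secants of \<open>A\<close>.\<close>

definition state :: "'p set \<Rightarrow> 'p set \<Rightarrow> bool" where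
  "state A S \<longleftrightarrow> A \<subseteq> points \<and> S \<subseteq> points \<and> A \<inter> S = {} \<and>
    (\<forall>L\<in>lines. \<forall>a\<in>L \<inter> A. \<forall>b\<in>L \<inter> A. a \<noteq> b \<longrightarrow> L \<inter> (A \<union> S) = {a, b})"

text \<open>The points of \<open>S\<close> that are lost when \<open>v\<close> is revealed, because
  a cap containing \<open>A\<close> and \<open>v\<close> cannot contain them.\<close>

definition nbrs :: "'p set \<Rightarrow> 'p set \<Rightarrow> 'p \<Rightarrow> 'p set" where
  "nbrs A S v = {y \<in> S. y \<noteq> v \<and> (\<exists>a\<in>A. \<exists>L\<in>lines. a \<in> L \<and> v \<in> L \<and> y \<in> L)}"

lemma stateD:
  assumes "state A S" "L \<in> lines" "a \<in> L" "b \<in> L" "a \<in> A" "b \<in> A" "a \<noteq> b"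
  shows "L \<inter> (A \<union> S) = {a, b}"
  using assms unfolding state_def by blast

lemma state_finite: "state A S \<Longrightarrow> finite A" "state A S \<Longrightarrow> finite S"
  using finite_points finite_subset by (auto simp: state_def)

lemma state_remove:
  assumes st: "state A S" and v: "v \<in> S"
  shows "state A (S - {v})"
proof -
  have "L \<inter> (A \<union> (S - {v})) = {a, b}"
    if "L \<in> lines" "a \<in> L \<inter> A" "b \<in> L \<inter> A" "a \<noteq> b" for L a b
    using stateD[OF st that(1), of a b] that v st unfolding state_def by blast
  moreover have "A \<subseteq> points" "S - {v} \<subseteq> points" "A \<inter> (S - {v}) = {}"
    using st by (auto simp: state_def)
  ultimately show ?thesis unfolding state_def by blast
qed

text \<open>The new secants join \<open>v\<close> to points of \<open>A\<close>, and removing the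
  neighbours of \<open>v\<close> clears \<open>S\<close> from them. A third point of
  \<open>A\<close> on one would put \<open>v\<close> on an old secant, which \<open>S\<close>
  avoids.\<close>

lemma state_insert:
  assumes st: "state A S" and v: "v \<in> S"
  shows "state (insert v A) (S - {v} - nbrs A S v)"
proof -
  let ?S = "S - {v} - nbrs A S v"
  have vA: "v \<notin> A" using st v by (auto simp: state_def)
  have secant: "L \<inter> (insert v A \<union> ?S) = {v, b}" if L: "L \<in> lines" "v \<in> L" "b \<in> L" "b \<in> A" for L b
  proof -
    have "y \<notin> L" if "y \<in> ?S" for y
      using that L unfolding nbrs_def by blast
    moreover have "y = b" if "y \<in> A" "y \<in> L" for y
    proof (rule ccontr)
      assume "y \<noteq> b"
      then have "L \<inter> (A \<union> S) = {y, b}" using stateD[OF st L(1), of y b] L that by simp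
      then have "v \<in> {y, b}" using v L(2) by blast
      then show False using vA L(4) that(1) by blast
    qed
    ultimately show ?thesis using L by blast
  qed
  have "L \<inter> (insert v A \<union> ?S) = {a, b}"
    if "L \<in> lines" "a \<in> L \<inter> insert v A" "b \<in> L \<inter> insert v A" "a \<noteq> b" for L a b
  proof -
    consider "a = v" "b \<in> A" | "b = v" "a \<in> A" | "a \<in> A" "b \<in> A" "a \<noteq> v" "b \<noteq> v"
      using \<open>a \<in> L \<inter> insert v A\<close> \<open>b \<in> L \<inter> insert v A\<close> \<open>a \<noteq> b\<close> vA by blast
    then show ?thesis
    proof cases
      case 1
      then show ?thesis using secant[OF that(1), of b] that by simp
    next
      case 2
      then show ?thesis using secant[OF that(1), of a] that by (simp add: insert_commute)
    next
      case 3
      then have "L \<inter> (A \<union> S) = {a, b}" using stateD[OF st that(1), of a b] that by simp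
      then show ?thesis using v 3 by blast
    qed
  qed
  moreover have "insert v A \<subseteq> points" "?S \<subseteq> points" "insert v A \<inter> ?S = {}"
    using st v by (auto simp: state_def)
  ultimately show ?thesis unfolding state_def by blast
qed

text \<open>The lines from \<open>x\<close> to the points of \<open>A\<close> are distinct, for a
  common one would be a secant of \<open>A\<close> through a point of \<open>S\<close>. Hence each
  neighbour is counted once and the sum is exact.\<close>

lemma card_nbrs:
  assumes st: "state A S" and x: "x \<in> S"
  shows "card (nbrs A S x) = (\<Sum>a\<in>A. card (join a x \<inter> S - {x}))"
proof -
  have jn: "join a x \<in> lines" "a \<in> join a x" "x \<in> join a x" "a \<noteq> x" if "a \<in> A" for a
  proof -
    show ne: "a \<noteq> x" using st that x by (auto simp: state_def)
    have "a \<in> points" "x \<in> points" using st that x by (auto simp: state_def)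
    from join[OF this ne] show "join a x \<in> lines" "a \<in> join a x" "x \<in> join a x" by auto
  qed
  have "nbrs A S x = (\<Union>a\<in>A. join a x \<inter> S - {x})"
  proof (intro equalityI subsetI)
    fix y assume "y \<in> nbrs A S x"
    then obtain a L where "y \<in> S" "y \<noteq> x" "a \<in> A" "L \<in> lines" "a \<in> L" "x \<in> L" "y \<in> L"
      by (auto simp: nbrs_def)
    then show "y \<in> (\<Union>a\<in>A. join a x \<inter> S - {x})"
      using join_eq[of L a x] jn(4)[of a] by auto
  next
    fix y assume "y \<in> (\<Union>a\<in>A. join a x \<inter> S - {x})"
    then obtain a where "a \<in> A" "y \<in> join a x" "y \<in> S" "y \<noteq> x" by auto
    then show "y \<in> nbrs A S x" using jn[of a] unfolding nbrs_def by blast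
  qed
  also have "card \<dots> = (\<Sum>a\<in>A. card (join a x \<inter> S - {x}))"
  proof (rule card_UN_disjoint)
    show "finite A" "\<forall>a\<in>A. finite (join a x \<inter> S - {x})" using state_finite[OF st] by auto
    show "\<forall>a\<in>A. \<forall>b\<in>A. a \<noteq> b \<longrightarrow> (join a x \<inter> S - {x}) \<inter> (join b x \<inter> S - {x}) = {}"
    proof (intro ballI impI)
      fix a b assume ab: "a \<in> A" "b \<in> A" "a \<noteq> b"
      show "(join a x \<inter> S - {x}) \<inter> (join b x \<inter> S - {x}) = {}"
      proof (rule ccontr)
        assume "\<not> ?thesis"
        then obtain y where "y \<in> join a x" "y \<in> join b x" "y \<noteq> x" by auto
        then have "join a x = join b x"
          using line_unique[of "join a x" "join b x" x y] jn ab by auto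
        then have "join a x \<inter> (A \<union> S) = {a, b}"
          using stateD[OF st, of "join a x" a b] jn ab by auto
        then show False using x jn ab by blast
      qed
    qed
  qed
  finally show ?thesis .
qed

text \<open>The lines through \<open>a\<close> that contain no other point of \<open>A\<close> number \<open>q\<^sup>2 + q + 2 - |A|\<close>, and they
  cover \<open>S\<close>; counting pairs of points of \<open>S\<close> on them is Cauchy--Schwarz.\<close>

lemma sum_card_join_ge:
  assumes st: "state A S" and a: "a \<in> A"
  shows "real (card S) * (real (card A) + real (card S) - real (q^2 + q + 2))
    \<le> real (q^2 + q + 1) * (\<Sum>x\<in>S. real (card (join a x \<inter> S - {x})))"
proof -
  define F where "F = {L \<in> star a. L \<inter> A = {a}}"
  define n where "n L = card (L \<inter> S)" for L
  have fin: "finite A" "finite S" using state_finite[OF st] by auto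
  have ap: "a \<in> points" and sub: "A \<subseteq> points" "S \<subseteq> points" and aS: "a \<notin> S"
    using st a by (auto simp: state_def)
  have FS: "F \<subseteq> star a" "finite F" using finite_star by (auto simp: F_def)
  \<comment> \<open>A line through \<open>a\<close> is either tangent to \<open>A\<close>, hence in
    \<open>F\<close>, or a secant, with one more point of \<open>A\<close> and none of
    \<open>S\<close>.\<close>
  have other: "L \<inter> (A - {a}) = {} \<and> L \<in> F \<or> card (L \<inter> (A - {a})) = 1 \<and> L \<inter> S = {} \<and> L \<notin> F"
    if L: "L \<in> star a" for L
  proof (cases "L \<inter> (A - {a}) = {}")
    case True
    then show ?thesis using L a by (auto simp: F_def star_def)
  next
    case False
    then obtain b where b: "b \<in> L" "b \<in> A" "b \<noteq> a" by auto
    then have "L \<inter> (A \<union> S) = {a, b}" using stateD[OF st, of L a b] a L by (auto simp: star_def)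
    then have "L \<inter> (A - {a}) = {b}" "L \<inter> S = {}" using aS b st by (auto simp: state_def)
    moreover have "L \<notin> F" using b by (auto simp: F_def)
    ultimately show ?thesis by simp
  qed
  have one: "card (L \<inter> (A - {a})) = (if L \<in> F then 0 else 1)" if "L \<in> star a" for L
    using other[OF that] by auto
  \<comment> \<open>Secants through \<open>a\<close> correspond to the other points of
    \<open>A\<close>, which gives the size of \<open>F\<close>.\<close>
  have "card A - 1 = (\<Sum>L\<in>star a. card (L \<inter> (A - {a})))"
    using sum_card_star[OF ap, of "A - {a}"] subset_trans[OF Diff_subset sub(1)] a fin by simp
  also have "\<dots> = (\<Sum>L\<in>star a - F. 1)"
    using one finite_star by (intro sum.mono_neutral_cong_right) auto
  finally have cF: "card A - 1 = card (star a) - card F"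
    using FS by (simp add: card_Diff_subset)
  moreover have "card F \<le> card (star a)" using FS finite_star card_mono by blast
  moreover have "card A \<ge> 1" using a fin card_gt_0_iff[of A] by (auto simp: Suc_le_eq)
  ultimately have "card A + card F = q^2 + q + 2"
    using card_star[OF ap] by linarith
  then have cardF: "real (card A) + real (card F) = real (q^2 + q + 2)"
    by (metis of_nat_add)
  have "(\<Sum>L\<in>F. n L) = (\<Sum>L\<in>star a. n L)"
    using other finite_star FS by (intro sum.mono_neutral_left) (force simp: n_def)+
  also have "\<dots> = card S" using sum_card_star[OF ap sub(2) aS] by (simp add: n_def)
  finally have sumF: "(\<Sum>L\<in>F. real (n L)) = real (card S)" by (metis of_nat_sum)
  \<comment> \<open>The points \<open>x\<close> are grouped by the line joining them to
    \<open>a\<close>. A line with \<open>n L\<close> points of \<open>S\<close> contributes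
    \<open>n L\<close> for each of them, hence a square.\<close>
  have "(\<Sum>x\<in>S. real (n (join a x))) = (\<Sum>L\<in>star a. \<Sum>x\<in>{x \<in> S. join a x = L}. real (n (join a x)))"
  proof (rule sum.group[symmetric])
    show "finite S" "finite (star a)" using fin finite_star by auto
    have "join a x \<in> star a" if "x \<in> S" for x
      using join[OF ap, of x] that sub(2) aS by (auto simp: star_def)
    then show "join a ` S \<subseteq> star a" by auto
  qed
  also have "\<dots> = (\<Sum>L\<in>star a. (real (n L))\<^sup>2)"
  proof (rule sum.cong[OF refl])
    fix L assume L: "L \<in> star a"
    have "join a x = L \<longleftrightarrow> x \<in> L" if "x \<in> S" for x
      using join[OF ap, of x] join_eq[of L a x] that L sub aS by (auto simp: star_def)
    then have "{x \<in> S. join a x = L} = L \<inter> S" by auto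
    then have "card {x \<in> S. join a x = L} = n L" by (simp add: n_def)
    moreover have "(\<Sum>x\<in>{x \<in> S. join a x = L}. real (n (join a x))) = (\<Sum>x\<in>{x \<in> S. join a x = L}. real (n L))"
      by (rule sum.cong) auto
    ultimately show "(\<Sum>x\<in>{x \<in> S. join a x = L}. real (n (join a x))) = (real (n L))\<^sup>2"
      by (simp add: power2_eq_square)
  qed
  also have "\<dots> \<ge> (\<Sum>L\<in>F. (real (n L))\<^sup>2)"
    using FS finite_star by (intro sum_mono2) auto
  finally have Q: "(\<Sum>L\<in>F. (real (n L))\<^sup>2) \<le> (\<Sum>x\<in>S. real (n (join a x)))" .
  have cs: "(real (card S))\<^sup>2 \<le> real (card F) * (\<Sum>x\<in>S. real (n (join a x)))"
    using sum_squared_le_sum_of_squares[of "\<lambda>L. real (n L)" F] Q sumF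
      mult_left_mono[OF Q, of "real (card F)"] by (simp add: mult.commute)
  define D where "D = (\<Sum>x\<in>S. real (card (join a x \<inter> S - {x})))"
  \<comment> \<open>\<open>n\<close> counts \<open>x\<close> itself, so the sum exceeds
    \<open>D\<close> by \<open>card S\<close>.\<close>
  have "real (n (join a x)) = real (card (join a x \<inter> S - {x})) + 1" if "x \<in> S" for x
  proof -
    have "x \<in> join a x \<inter> S" using join[OF ap, of x] that sub aS by auto
    then have "card (join a x \<inter> S) = Suc (card (join a x \<inter> S - {x}))"
      using fin by (metis card.remove finite_Int)
    then show ?thesis by (simp add: n_def)
  qed
  then have D: "(\<Sum>x\<in>S. real (n (join a x))) = D + real (card S)"
    by (simp add: D_def sum.distrib)
  have "real (card S) * (real (card A) + real (card S) - real (q^2 + q + 2))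
    = (real (card S))\<^sup>2 - real (card F) * real (card S)"
    unfolding cardF[symmetric] by (simp add: algebra_simps power2_eq_square)
  also have "\<dots> \<le> real (card F) * D"
    using cs unfolding D by (simp add: algebra_simps)
  also have "\<dots> \<le> real (q^2 + q + 1) * D"
  proof (rule mult_right_mono)
    show "real (card F) \<le> real (q^2 + q + 1)"
      using card_mono[OF finite_star FS(1)] unfolding card_star[OF ap] by (rule of_nat_mono)
    show "0 \<le> D" by (simp add: D_def sum_nonneg)
  qed
  finally show ?thesis unfolding D_def .
qed

text \<open>Averaging: summing \<open>sum_card_join_ge\<close> over \<open>A\<close> and exchanging
  the sums bounds the total number of neighbours from below, so some point of \<open>S\<close>
  attains the average.\<close>

lemma exists_large_nbrs:
  assumes st: "state A S" and S: "S \<noteq> {}"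
  shows "\<exists>v\<in>S. real (card A) * (real (card A) + real (card S) - real (q^2 + q + 2))
    \<le> real (q^2 + q + 1) * real (card (nbrs A S v))"
proof (rule ccontr)
  define m where "m = real (q^2 + q + 1)"
  \<comment> \<open>The excess is measured against \<open>q^2 + q + 2\<close>, the container size
    before a last point is dropped, so it is \<open>card A + card S - (m + 1)\<close>.\<close>
  define e where "e = real (card A) + real (card S) - real (q^2 + q + 2)"
  assume "\<not> ?thesis"
  then have small: "m * real (card (nbrs A S v)) < real (card A) * e" if "v \<in> S" for v
    using that by (auto simp: m_def e_def not_le)
  have fin: "finite A" "finite S" using state_finite[OF st] by auto
  have "(\<Sum>v\<in>S. m * real (card (nbrs A S v))) < (\<Sum>v\<in>S. real (card A) * e)"
    using small fin S by (intro sum_strict_mono) auto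
  also have "\<dots> = (\<Sum>a\<in>A. real (card S) * e)" by simp
  also have "\<dots> \<le> (\<Sum>a\<in>A. m * (\<Sum>x\<in>S. real (card (join a x \<inter> S - {x}))))"
    using sum_card_join_ge[OF st] unfolding m_def e_def by (intro sum_mono) auto
  also have "\<dots> = m * (\<Sum>x\<in>S. \<Sum>a\<in>A. real (card (join a x \<inter> S - {x})))"
    by (subst sum.swap) (simp add: sum_distrib_left)
  also have "\<dots> = m * (\<Sum>x\<in>S. real (card (nbrs A S x)))"
    using card_nbrs[OF st] by simp
  finally show False by (simp add: sum_distrib_left)
qed

text \<open>Guarantees that a state with more than \<open>q^2 + q + 2\<close> points still has a
  point to branch on. For empty \<open>S\<close> the state condition makes \<open>A\<close> a cap,
  so each line through \<open>a\<close> has at most one more point of it.\<close>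

lemma state_card_le:
  assumes st: "state A {}"
  shows "card A \<le> q^2 + q + 2"
proof (cases "A = {}")
  case False
  then obtain a where a: "a \<in> A" by auto
  have A: "A \<subseteq> points" "finite A" using st state_finite by (auto simp: state_def)
  have "card (L \<inter> (A - {a})) \<le> 1" if L: "L \<in> star a" for L
  proof (cases "L \<inter> (A - {a}) = {}")
    case False
    then obtain b where b: "b \<in> L" "b \<in> A" "b \<noteq> a" by auto
    then have "L \<inter> (A \<union> {}) = {a, b}" using stateD[OF st, of L a b] a L by (auto simp: star_def)
    then have "L \<inter> (A - {a}) = {b}" using b by auto
    then show ?thesis by simp
  qed simp
  then have "(\<Sum>L\<in>star a. card (L \<inter> (A - {a}))) \<le> (\<Sum>L\<in>star a. 1)"
    by (rule sum_mono)
  then have "card A - 1 \<le> q^2 + q + 1"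
    using sum_card_star[of a "A - {a}"] card_star[of a] subset_trans[OF Diff_subset A(1)] a A by auto
  then show ?thesis by simp
qed simp

text \<open>Branch on a point \<open>v\<close> with many neighbours. Excluding \<open>v\<close> removes one point of \<open>S\<close>, while
  including it removes all neighbours as well; the exponent bounds the number of inclusions, since once
  \<open>|A| \<ge> q\<close> each of them shrinks the excess by the factor \<open>1 - q / (q\<^sup>2 + q + 1)\<close>.\<close>

lemma containers_from_state:
  assumes "state A S"
    and "(real (card A) + real (card S) - real (q^2 + q + 2)) * (1 - real q / real (q^2 + q + 1)) ^ J < 1"
  shows "\<exists>\<C>. finite \<C> \<and> card \<C> \<le> (card S + 1) ^ ((q - card A) + J) \<and>
    (\<forall>C\<in>\<C>. C \<subseteq> points \<and> card C \<le> q^2 + q + 2) \<and>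
    (\<forall>I. cap I \<longrightarrow> A \<subseteq> I \<longrightarrow> I \<subseteq> A \<union> S \<longrightarrow> (\<exists>C\<in>\<C>. I \<subseteq> C))"
  using assms
\<comment> \<open>Both branches shrink \<open>S\<close>, and including \<open>v\<close> may lower
  \<open>J\<close>, so the induction is on \<open>card S\<close> with \<open>J\<close>
  general.\<close>
proof (induction "card S" arbitrary: A S J rule: less_induct)
  case less
  note st = less.prems(1)
  define e where "e A S = real (card A) + real (card S) - real (q^2 + q + 2)" for A S :: "'p set"
  define \<rho> where "\<rho> = 1 - real q / real (q^2 + q + 1)"
  have \<rho>: "0 \<le> \<rho>" by (simp add: \<rho>_def divide_le_eq)
  have m_pos: "0 < real (q^2 + q + 1)" by (simp only: of_nat_0_less_iff)
  have fin: "finite A" "finite S" using state_finite[OF st] by auto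
  have disj: "A \<inter> S = {}" and sub: "A \<union> S \<subseteq> points" using st by (auto simp: state_def)
  show ?case
  proof (cases "card A + card S \<le> q^2 + q + 2")
    case True
    have "card (A \<union> S) \<le> q^2 + q + 2"
      using True card_Un_disjoint[OF fin disj] by simp
    then show ?thesis
      using sub by (intro exI[of _ "{A \<union> S}"]) simp
  next
    case False
    then have S: "S \<noteq> {}" using state_card_le st by force
    have "q^2 + q + 3 \<le> card A + card S" using False by simp
    then have "real (q^2 + q + 3) \<le> real (card A + card S)" by (rule of_nat_mono)
    \<comment> \<open>The excess is integral, so beyond the limit it is at least 1; together with
      \<open>eJ\<close> this later forces \<open>J\<close> to be positive.\<close>
    then have e1: "e A S \<ge> 1" by (simp add: e_def)
    obtain v where v: "v \<in> S"
      and deg: "real (card A) * e A S \<le> real (q^2 + q + 1) * real (card (nbrs A S v))"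
      using exists_large_nbrs[OF st S] unfolding e_def by auto
    have vA: "v \<notin> A" using v disj by auto
    define S' where "S' = S - {v} - nbrs A S v"
    have c1: "Suc (card (S - {v})) = card S" using v fin by (metis card.remove)
    have "nbrs A S v \<subseteq> S - {v}" by (auto simp: nbrs_def)
    then have c2: "card S = Suc (card S' + card (nbrs A S v))"
      unfolding S'_def using c1 fin
      by (metis Suc_inject card_Diff_subset card_mono finite_Diff finite_subset le_add_diff_inverse2)
    have e_yes: "e (insert v A) S' = e A S - real (card (nbrs A S v))"
      using c2 vA fin by (simp add: e_def)
    have e_no: "e A (S - {v}) \<le> e A S" using c1 by (simp add: e_def)
    have eJ: "e A S * \<rho> ^ J < 1" using less.prems(2) by (simp add: e_def \<rho>_def)
    \<comment> \<open>Including \<open>v\<close> costs exactly one unit of the exponent: below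
      \<open>q\<close> points the truncated difference \<open>q - card A\<close> drops, afterwards
      \<open>J\<close> drops because the excess shrinks by \<open>\<rho>\<close>.\<close>
    obtain J' where J': "(q - card A) + J = Suc ((q - card (insert v A)) + J')"
      and eJ': "e (insert v A) S' * \<rho> ^ J' < 1"
    proof (cases "card A < q")
      case True
      have "e (insert v A) S' * \<rho> ^ J \<le> e A S * \<rho> ^ J"
        using e_yes \<rho> by (intro mult_right_mono) auto
      then show ?thesis using that[of J] True vA fin eJ by simp
    next
      case False
      obtain J' where J: "J = Suc J'" using eJ e1 by (cases J) auto
      have "real q * e A S \<le> real (card A) * e A S"
        using False e1 by (intro mult_right_mono) auto
      then have "real q * e A S \<le> real (q^2 + q + 1) * real (card (nbrs A S v))"
        using deg by linarith
      then have "e A S * (real q / real (q^2 + q + 1)) \<le> real (card (nbrs A S v))"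
        by (subst times_divide_eq_right, subst pos_divide_le_eq) (simp_all only: mult.commute m_pos)
      then have "e (insert v A) S' \<le> e A S * \<rho>"
        unfolding e_yes \<rho>_def by (simp add: right_diff_distrib)
      then have "e (insert v A) S' * \<rho> ^ J' \<le> e A S * \<rho> * \<rho> ^ J'"
        using \<rho> by (intro mult_right_mono) auto
      then have "e (insert v A) S' * \<rho> ^ J' < 1"
        using eJ J by (simp add: mult.assoc)
      then show ?thesis using that[of J'] False vA fin J by simp
    qed
    define k where "k = (q - card (insert v A)) + J'"
    have "e A (S - {v}) * \<rho> ^ J \<le> e A S * \<rho> ^ J"
      using e_no \<rho> by (intro mult_right_mono) auto
    then have "e A (S - {v}) * \<rho> ^ J < 1" using eJ by linarith
    note no = less.hyps[OF _ state_remove[OF st v] this[unfolded e_def \<rho>_def]]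
    have lt: "card (S - {v}) < card S" "card S' < card S" using c1 c2 by simp_all
    have k: "(q - card A) + J = Suc k" using J' by (simp add: k_def)
    have c1': "card (S - {v}) + 1 = card S" using c1 by simp
    obtain C1 where C1: "finite C1" "card C1 \<le> card S ^ Suc k"
      "\<forall>C\<in>C1. C \<subseteq> points \<and> card C \<le> q^2 + q + 2"
      "\<forall>I. cap I \<longrightarrow> A \<subseteq> I \<longrightarrow> I \<subseteq> A \<union> (S - {v}) \<longrightarrow> (\<exists>C\<in>C1. I \<subseteq> C)"
      using no[OF lt(1)] unfolding k c1' by blast
    obtain C2 where C2: "finite C2" "card C2 \<le> (card S' + 1) ^ k"
      "\<forall>C\<in>C2. C \<subseteq> points \<and> card C \<le> q^2 + q + 2"
      "\<forall>I. cap I \<longrightarrow> insert v A \<subseteq> I \<longrightarrow> I \<subseteq> insert v A \<union> S' \<longrightarrow> (\<exists>C\<in>C2. I \<subseteq> C)"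
      using less.hyps[OF lt(2) state_insert[OF st v, folded S'_def] eJ'[unfolded e_def \<rho>_def]]
      unfolding k_def by blast
    \<comment> \<open>With \<open>s = card S\<close> the two branches give
      \<open>s ^ Suc k + s ^ k = s ^ k * (s + 1)\<close>, within \<open>(s + 1) ^ Suc k\<close>. The
      exclusion branch keeps its exponent but loses a point, so its base is
      \<open>s\<close>.\<close>
    have "card (C1 \<union> C2) \<le> card S ^ Suc k + (card S' + 1) ^ k"
      using card_Un_le[of C1 C2] C1(2) C2(2) by linarith
    also have "\<dots> \<le> card S ^ Suc k + card S ^ k"
      using c2 by (intro add_left_mono power_mono) auto
    also have "\<dots> = card S ^ k * (card S + 1)" by simp
    also have "\<dots> \<le> (card S + 1) ^ k * (card S + 1)"
      by (intro mult_right_mono power_mono) auto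
    also have "\<dots> = (card S + 1) ^ ((q - card A) + J)"
      unfolding k by simp
    finally have card: "card (C1 \<union> C2) \<le> (card S + 1) ^ ((q - card A) + J)" .
    \<comment> \<open>A cap containing \<open>v\<close> avoids the neighbours of \<open>v\<close>,
      so the inclusion branch covers it; any other cap belongs to the exclusion branch.\<close>
    have cover: "\<exists>C\<in>C1 \<union> C2. I \<subseteq> C" if I: "cap I" "A \<subseteq> I" "I \<subseteq> A \<union> S" for I
    proof (cases "v \<in> I")
      case True
      have "y \<notin> I" if y: "y \<in> nbrs A S v" for y
      proof
        assume "y \<in> I"
        obtain a L where "y \<in> S" "y \<noteq> v" "a \<in> A" "L \<in> lines" "a \<in> L" "v \<in> L" "y \<in> L"
          using y by (auto simp: nbrs_def)
        then show False
          using cap_unique[OF I(1), of L a v y] I True \<open>y \<in> I\<close> vA disj by auto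
      qed
      then have "I \<subseteq> insert v A \<union> S'" using I by (auto simp: S'_def)
      moreover have "insert v A \<subseteq> I" using I True by simp
      ultimately show ?thesis using C2(4) I(1) by blast
    next
      case False
        then have "I \<subseteq> A \<union> (S - {v})" using I by auto
      then show ?thesis using C1(4) I by blast
    qed
    show ?thesis
    proof (intro exI[of _ "C1 \<union> C2"] conjI)
      show "finite (C1 \<union> C2)" using C1(1) C2(1) by simp
      show "\<forall>C\<in>C1 \<union> C2. C \<subseteq> points \<and> card C \<le> q^2 + q + 2"
        using C1(3) C2(3) by blast
    qed (use card cover in blast)+
  qed
qed

text \<open>The branching starts from the empty set with all points as candidates. Then
  \<open>J\<close> of order \<open>q ln q\<close> suffices, and a base of at most \<open>q^4\<close>
  turns the exponent \<open>q + J\<close> into a bound of order \<open>q ln^2 q\<close>.\<close>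

lemma exists_cap_containers:
  assumes q: "q \<ge> 3"
  shows "\<exists>\<C>. (\<forall>C\<in>\<C>. C \<subseteq> points \<and> card C \<le> q^2 + q + 1) \<and> (\<forall>I. cap I \<longrightarrow> (\<exists>C\<in>\<C>. I \<subseteq> C)) \<and>
    ln (real (card \<C>)) \<le> 40 * real q * (ln (real q))\<^sup>2"
proof -
  define m where "m = q^2 + q + 1"
  define \<rho> where "\<rho> = 1 - real q / real m"
  \<comment> \<open>The factor 8 comes from \<open>m \<le> 2 * q^2\<close>: then
    \<open>J * q / m\<close> is at least \<open>4 * ln q\<close>, enough to beat an initial excess
    below \<open>q^4\<close>.\<close>
  define J where "J = nat \<lceil>8 * real q * ln (real q)\<rceil>"
  have lnq: "ln (real q) \<ge> 1"
    using q exp_le by (subst ln_ge_iff) auto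
  have m: "0 < m" "m \<le> 2 * q^2"
  proof -
    have "3 * q \<le> q * q" using q by (rule mult_right_mono) simp
    then show "m \<le> 2 * q^2" unfolding m_def power2_eq_square using q by linarith
  qed (simp add: m_def)
  have N: "card points + 1 \<le> q^4"
  proof -
    have "3 * q^3 \<le> q^4" "3 * q^2 \<le> q^3" "3 * q \<le> q^2"
      using q by (auto simp: power2_eq_square power3_eq_cube power4_eq_xxxx intro!: mult_right_mono)
    then show ?thesis using q unfolding card_points by linarith
  qed
  have J_ge: "8 * real q * ln (real q) \<le> real J"
    unfolding J_def by linarith
  have J_le: "real J \<le> 8 * real q * ln (real q) + 1"
  proof -
    have "0 \<le> 8 * real q * ln (real q)" using lnq by simp
    then show ?thesis unfolding J_def by linarith
  qed
  \<comment> \<open>From \<open>1 - x \<le> exp (- x)\<close> the shrinking factor after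
    \<open>J\<close> inclusions is at most \<open>1 / q^4\<close>.\<close>
  have "\<rho> ^ J \<le> exp (- (real q / real m)) ^ J"
  proof (rule power_mono)
    show "\<rho> \<le> exp (- (real q / real m))"
      using exp_ge_add_one_self[of "- (real q / real m)"] by (simp add: \<rho>_def)
    show "0 \<le> \<rho>" using m by (simp add: \<rho>_def m_def divide_le_eq)
  qed
  also have "\<dots> = exp (- (real J * (real q / real m)))"
    by (simp add: exp_of_nat_mult[symmetric])
  also have "\<dots> \<le> exp (- (4 * ln (real q)))"
  proof -
    have "4 * ln (real q) * real m \<le> 4 * ln (real q) * real (2 * q^2)"
      using m lnq by (intro mult_left_mono of_nat_mono) auto
    also have "\<dots> = 8 * real q * ln (real q) * real q"
      by (simp add: power2_eq_square)
    also have "\<dots> \<le> real J * real q"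
      using J_ge by (rule mult_right_mono) simp
    finally have "4 * ln (real q) \<le> real J * (real q / real m)"
      using m by (simp add: le_divide_eq)
    then show ?thesis by simp
  qed
  also have "\<dots> = 1 / real q ^ 4"
  proof -
    have "exp (4 * ln (real q)) = real q ^ 4"
      using q exp_of_nat_mult[of 4 "ln (real q)"] by simp
    then show ?thesis by (simp add: exp_minus field_simps)
  qed
  finally have \<rho>J: "\<rho> ^ J \<le> 1 / real q ^ 4" .
  have N_real: "real (card points) < real q ^ 4"
  proof -
    have "card points < q^4" using N by linarith
    then have "real (card points) < real (q^4)" by (rule of_nat_less_iff[THEN iffD2])
    then show ?thesis by (simp only: of_nat_power)
  qed
  have "(real (card {}) + real (card points) - real (q^2 + q + 2)) * \<rho> ^ J < 1"
  proof -
    have "0 \<le> \<rho>" using m by (simp add: \<rho>_def m_def divide_le_eq)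
    have "(real (card {}) + real (card points) - real (q^2 + q + 2)) * \<rho> ^ J \<le> real (card points) * \<rho> ^ J"
    proof (rule mult_right_mono)
      have "0 \<le> real (q^2 + q + 2)" by (rule of_nat_0_le_iff)
      then show "real (card {}) + real (card points) - real (q^2 + q + 2) \<le> real (card points)"
        by (simp only: card.empty of_nat_0 add_0)
    qed (use \<open>0 \<le> \<rho>\<close> in simp)
    also have "\<dots> \<le> real (card points) * (1 / real q ^ 4)"
      using \<rho>J by (intro mult_left_mono) auto
    also have "\<dots> < 1" using N_real q by (simp add: divide_less_eq)
    finally show ?thesis .
  qed
  note small = this[unfolded \<rho>_def m_def]
  have "state {} points" by (simp add: state_def)
  from containers_from_state[OF this small]
  obtain D where D: "finite D" "card D \<le> (card points + 1) ^ (q + J)"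
    "\<forall>C\<in>D. C \<subseteq> points \<and> card C \<le> q^2 + q + 2"
    "\<forall>I. cap I \<longrightarrow> {} \<subseteq> I \<longrightarrow> I \<subseteq> {} \<union> points \<longrightarrow> (\<exists>C\<in>D. I \<subseteq> C)"
    unfolding card.empty diff_zero by (elim exE conjE) (rule that; assumption)
  \<comment> \<open>No cap fills a container of size \<open>q\<^sup>2 + q + 2\<close>, so one point can be dropped from each.\<close>
  define E where "E = {C \<in> (\<lambda>(C, x). C - {x}) ` (D \<times> points). card C \<le> q^2 + q + 1}"
  have E_I: "C - {x} \<in> E" if "C \<in> D" "x \<in> points" "card (C - {x}) \<le> q^2 + q + 1" for C x
    using that unfolding E_def by (intro CollectI conjI image_eqI[of _ _ "(C, x)"]) simp_all
  have cover: "\<exists>C\<in>E. I \<subseteq> C" if I: "cap I" for I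
  proof -
    have Ip: "I \<subseteq> points" using I by (simp add: cap_def)
    then obtain C where C: "C \<in> D" "I \<subseteq> C" using D(4) I by blast
    have C': "C \<subseteq> points" "card C \<le> q^2 + q + 2" using D(3) C(1) by auto
    have cI: "card I \<le> q^2 + q + 1" by (rule card_cap_le[OF I q])
    have "\<exists>x\<in>points. x \<notin> I \<and> card (C - {x}) \<le> q^2 + q + 1"
    proof (cases "card C \<le> q^2 + q + 1")
      case True
      \<comment> \<open>Here any point \<open>x\<close> outside the cap will do, even one outside
        \<open>C\<close>; this keeps all members of \<open>E\<close> of the form
        \<open>C - {x}\<close>.\<close>
      have "0 < q^3" using q by simp
      then have "card I < card points" using cI unfolding card_points by linarith
      then have "\<not> points \<subseteq> I" using Ip by auto
      then obtain x where "x \<in> points" "x \<notin> I" by blast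
      moreover have "card (C - {x}) \<le> q^2 + q + 1"
        using card_Diff1_le[of C x] True by (rule le_trans)
      ultimately show ?thesis by blast
    next
      case False
      then have "\<not> C \<subseteq> I" using cI C(2) by auto
      then obtain x where x: "x \<in> C" "x \<notin> I" by blast
      have "card (C - {x}) = card C - 1" using x(1) by (rule card_Diff_singleton)
      then have "card (C - {x}) \<le> q^2 + q + 1" using C'(2) by linarith
      then show ?thesis using x C'(1) by blast
    qed
    then obtain x where x: "x \<in> points" "x \<notin> I" "card (C - {x}) \<le> q^2 + q + 1" by blast
    show ?thesis
    proof (rule bexI)
      show "I \<subseteq> C - {x}" using C(2) x(2) by auto
      show "C - {x} \<in> E" by (rule E_I[OF C(1) x(1,3)])
    qed
  qed
  \<comment> \<open>The additional 1 in the exponent pays for the choice of the dropped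
    point.\<close>
  have "card E \<le> (q^4) ^ (q + J + 1)"
  proof -
    have "card E \<le> card ((\<lambda>(C, x). C - {x}) ` (D \<times> points))"
      using D(1) finite_points by (intro card_mono) (auto simp: E_def)
    also have "\<dots> \<le> card D * card points"
      using card_image_le[of "D \<times> points" "\<lambda>(C, x). C - {x}"] D(1) finite_points
      by (simp add: card_cartesian_product)
    also have "\<dots> \<le> (q^4) ^ (q + J) * q^4"
    proof (rule mult_le_mono)
      show "card D \<le> (q^4) ^ (q + J)"
        using D(2) power_mono[OF N, of "q + J"] by linarith
      show "card points \<le> q^4" using N by linarith
    qed
    also have "\<dots> = (q^4) ^ (q + J + 1)" by (simp only: power_add power_one_right)
    finally show ?thesis .
  qed
  then have "real (card E) \<le> real ((q^4) ^ (q + J + 1))" by (rule of_nat_mono)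
  then have "real (card E) \<le> real q ^ (4 * (q + J + 1))"
    by (simp only: of_nat_power power_mult)
  \<comment> \<open>Comparing logarithms requires a positive cardinality; the container of the empty
    cap supplies it.\<close>
  moreover have "card E > 0"
  proof -
    have "cap {}" by (simp add: cap_def)
    then have "E \<noteq> {}" using cover by blast
    moreover have "finite E" using D(1) finite_points by (simp add: E_def)
    ultimately show ?thesis by (simp add: card_gt_0_iff)
  qed
  ultimately have "ln (real (card E)) \<le> ln (real q ^ (4 * (q + J + 1)))"
    using q by (subst ln_le_cancel_iff) auto
  also have "\<dots> = 4 * (real q + real J + 1) * ln (real q)"
    using q by (subst ln_realpow) auto
  \<comment> \<open>With \<open>t = q * ln q\<close>, which is at least \<open>q\<close> and hence
    at least 3, the bracket is at most \<open>t + (8 * t + 1) + 1\<close>, so at most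
    \<open>10 * t\<close>; the factor 4 from \<open>q^4\<close> makes it 40.\<close>
  also have "\<dots> \<le> 4 * (10 * real q * ln (real q)) * ln (real q)"
  proof (rule mult_right_mono)
    have "real q \<le> real q * ln (real q)" "3 \<le> real q"
      using mult_left_mono[OF lnq, of "real q"] q by simp_all
    moreover have "4 * (x + y + 1) \<le> 4 * (10 * t)" if "x \<le> t" "3 \<le> x" "y \<le> 8 * t + 1" for x y t :: real
      using that by simp
    ultimately show "4 * (real q + real J + 1) \<le> 4 * (10 * real q * ln (real q))"
      using J_le unfolding mult.assoc by blast
  qed (use lnq in simp)
  also have "\<dots> = 40 * real q * (ln (real q))\<^sup>2"
    by (simp add: power2_eq_square)
  finally have "ln (real (card E)) \<le> 40 * real q * (ln (real q))\<^sup>2" .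
  moreover have "C \<subseteq> points \<and> card C \<le> q^2 + q + 1" if "C \<in> E" for C
  proof -
    obtain C' x where "C' \<in> D" "C = C' - {x}" using \<open>C \<in> E\<close> by (auto simp: E_def)
    then show ?thesis using D(3) that by (auto simp: E_def)
  qed
  ultimately show ?thesis using cover by blast
qed

end

section \<open>The space PG(3,q)\<close>

locale finite_vector_space = module R M for R (structure) and M (structure) +
  assumes field: "field R"
    and finite_scalars: "finite (carrier R)"
    and finite_vectors: "finite (carrier M)"
begin

sublocale R: field R
  by (rule field)

definition pt :: "'c \<Rightarrow> 'c set" where
  "pt u = (\<lambda>a. a \<odot>\<^bsub>M\<^esub> u) ` carrier R"

definition span2 :: "'c \<Rightarrow> 'c \<Rightarrow> 'c set" where
  "span2 u v = (\<lambda>(a, b). a \<odot>\<^bsub>M\<^esub> u \<oplus>\<^bsub>M\<^esub> b \<odot>\<^bsub>M\<^esub> v) ` (carrier R \<times> carrier R)"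

definition indep :: "'c \<Rightarrow> 'c \<Rightarrow> bool" where
  "indep u v \<longleftrightarrow> (\<forall>a\<in>carrier R. \<forall>b\<in>carrier R.
    a \<odot>\<^bsub>M\<^esub> u \<oplus>\<^bsub>M\<^esub> b \<odot>\<^bsub>M\<^esub> v = \<zero>\<^bsub>M\<^esub> \<longrightarrow> a = \<zero> \<and> b = \<zero>)"

definition pts :: "'c set set" where
  "pts = pt ` (carrier M - {\<zero>\<^bsub>M\<^esub>})"

definition two_dim :: "'c set set" where
  "two_dim = {span2 u v |u v. u \<in> carrier M \<and> v \<in> carrier M \<and> indep u v}"

definition pts_of :: "'c set \<Rightarrow> 'c set set" where
  "pts_of W = {P \<in> pts. P \<subseteq> W}"

definition subsp :: "'c set \<Rightarrow> bool" where
  "subsp W \<longleftrightarrow> W \<subseteq> carrier M \<and> \<zero>\<^bsub>M\<^esub> \<in> W \<and> (\<forall>x\<in>W. \<forall>y\<in>W. x \<oplus>\<^bsub>M\<^esub> y \<in> W) \<and>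
    (\<forall>a\<in>carrier R. \<forall>x\<in>W. a \<odot>\<^bsub>M\<^esub> x \<in> W)"

lemma smult_eq_zero:
  assumes "a \<in> carrier R" "u \<in> carrier M" "a \<odot>\<^bsub>M\<^esub> u = \<zero>\<^bsub>M\<^esub>"
  shows "a = \<zero> \<or> u = \<zero>\<^bsub>M\<^esub>"
proof (rule disjCI)
  assume u: "u \<noteq> \<zero>\<^bsub>M\<^esub>"
  show "a = \<zero>"
  proof (rule ccontr)
    assume "a \<noteq> \<zero>"
    then have a: "inv a \<in> carrier R" "inv a \<otimes> a = \<one>"
      using assms(1) R.field_Units by auto
    then have "u = inv a \<odot>\<^bsub>M\<^esub> (a \<odot>\<^bsub>M\<^esub> u)"
      using assms(1,2) by (simp add: smult_assoc1[symmetric])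
    then show False using assms(3) a u by simp
  qed
qed

lemma self_in_pt: "u \<in> carrier M \<Longrightarrow> u \<in> pt u"
  unfolding pt_def by (rule image_eqI[of _ _ \<one>]) auto

lemma pt_subset: "subsp W \<Longrightarrow> u \<in> carrier M \<Longrightarrow> pt u \<subseteq> W \<longleftrightarrow> u \<in> W"
  using self_in_pt[of u] by (auto simp: pt_def subsp_def)

text \<open>The scalar taking \<open>u\<close> to \<open>w\<close> is invertible. Consequently
  distinct points share only the zero vector, and any nonzero vector represents its point.\<close>

lemma pt_eq:
  assumes u: "u \<in> carrier M" and w: "w \<in> pt u" "w \<noteq> \<zero>\<^bsub>M\<^esub>"
  shows "pt w = pt u"
proof -
  obtain a where a: "a \<in> carrier R" "w = a \<odot>\<^bsub>M\<^esub> u" using w(1) by (auto simp: pt_def)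
  then have "a \<noteq> \<zero>" using u w(2) by auto
  then have ia: "inv a \<in> carrier R" "inv a \<otimes> a = \<one>"
    using a(1) R.field_Units by auto
  have "b \<odot>\<^bsub>M\<^esub> w \<in> pt u" if "b \<in> carrier R" for b
    using that a u unfolding pt_def
    by (intro image_eqI[of _ _ "b \<otimes> a"]) (auto simp: smult_assoc1)
  moreover have "b \<odot>\<^bsub>M\<^esub> u \<in> pt w" if b: "b \<in> carrier R" for b
  proof -
    have "(b \<otimes> inv a) \<odot>\<^bsub>M\<^esub> w = (b \<otimes> (inv a \<otimes> a)) \<odot>\<^bsub>M\<^esub> u"
      using a ia(1) b u by (simp add: smult_assoc1 R.m_assoc)
    also have "\<dots> = b \<odot>\<^bsub>M\<^esub> u" using ia b by simp
    finally show ?thesis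
      using b ia(1) unfolding pt_def by (intro image_eqI[of _ _ "b \<otimes> inv a"]) auto
  qed
  ultimately show ?thesis by (auto simp: pt_def[of w] pt_def[of u])
qed

lemma smult_diff:
  assumes "a \<in> carrier R" "b \<in> carrier R" "u \<in> carrier M"
  shows "(a \<ominus> b) \<odot>\<^bsub>M\<^esub> u = a \<odot>\<^bsub>M\<^esub> u \<oplus>\<^bsub>M\<^esub> (\<ominus>\<^bsub>M\<^esub> (b \<odot>\<^bsub>M\<^esub> u))"
  using assms by (simp add: a_minus_def smult_l_distr smult_l_minus)

lemma card_pt:
  assumes u: "u \<in> carrier M" "u \<noteq> \<zero>\<^bsub>M\<^esub>"
  shows "card (pt u) = card (carrier R)"
proof -
  have "inj_on (\<lambda>a. a \<odot>\<^bsub>M\<^esub> u) (carrier R)"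
  proof (rule inj_onI)
    fix a b assume ab: "a \<in> carrier R" "b \<in> carrier R" "a \<odot>\<^bsub>M\<^esub> u = b \<odot>\<^bsub>M\<^esub> u"
    then have "(a \<ominus> b) \<odot>\<^bsub>M\<^esub> u = \<zero>\<^bsub>M\<^esub>"
      using u by (simp add: smult_diff M.r_neg)
    then show "a = b" using smult_eq_zero[of "a \<ominus> b" u] u ab by simp
  qed
  then show ?thesis unfolding pt_def by (rule card_image)
qed

lemma subsp_carrier: "subsp (carrier M)"
  by (simp add: subsp_def)

lemma span2I:
  "a \<in> carrier R \<Longrightarrow> b \<in> carrier R \<Longrightarrow> a \<odot>\<^bsub>M\<^esub> u \<oplus>\<^bsub>M\<^esub> b \<odot>\<^bsub>M\<^esub> v \<in> span2 u v"
  unfolding span2_def by (rule image_eqI[of _ _ "(a, b)"]) auto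

lemma span2E:
  assumes "x \<in> span2 u v"
  obtains a b where "a \<in> carrier R" "b \<in> carrier R" "x = a \<odot>\<^bsub>M\<^esub> u \<oplus>\<^bsub>M\<^esub> b \<odot>\<^bsub>M\<^esub> v"
  using assms by (auto simp: span2_def)

lemma subsp_span2:
  assumes uv: "u \<in> carrier M" "v \<in> carrier M"
  shows "subsp (span2 u v)"
  unfolding subsp_def
proof (intro conjI ballI)
  show "span2 u v \<subseteq> carrier M" using uv by (auto simp: span2_def)
  show "\<zero>\<^bsub>M\<^esub> \<in> span2 u v" using span2I[of \<zero> \<zero> u v] uv by simp
next
  fix x y assume "x \<in> span2 u v" "y \<in> span2 u v"
  then obtain a b c d where ab: "a \<in> carrier R" "b \<in> carrier R" "c \<in> carrier R" "d \<in> carrier R"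
    and x: "x = a \<odot>\<^bsub>M\<^esub> u \<oplus>\<^bsub>M\<^esub> b \<odot>\<^bsub>M\<^esub> v" and y: "y = c \<odot>\<^bsub>M\<^esub> u \<oplus>\<^bsub>M\<^esub> d \<odot>\<^bsub>M\<^esub> v"
    by (metis span2E)
  have "x \<oplus>\<^bsub>M\<^esub> y = (a \<oplus> c) \<odot>\<^bsub>M\<^esub> u \<oplus>\<^bsub>M\<^esub> (b \<oplus> d) \<odot>\<^bsub>M\<^esub> v"
    unfolding x y using ab uv by (simp add: smult_l_distr M.a_ac)
  then show "x \<oplus>\<^bsub>M\<^esub> y \<in> span2 u v" using ab by (simp add: span2I)
next
  fix c x assume c: "c \<in> carrier R" and "x \<in> span2 u v"
  then obtain a b where ab: "a \<in> carrier R" "b \<in> carrier R"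
    and x: "x = a \<odot>\<^bsub>M\<^esub> u \<oplus>\<^bsub>M\<^esub> b \<odot>\<^bsub>M\<^esub> v" by (metis span2E)
  have "c \<odot>\<^bsub>M\<^esub> x = (c \<otimes> a) \<odot>\<^bsub>M\<^esub> u \<oplus>\<^bsub>M\<^esub> (c \<otimes> b) \<odot>\<^bsub>M\<^esub> v"
    unfolding x using ab c uv by (simp add: smult_r_distr smult_assoc1)
  then show "c \<odot>\<^bsub>M\<^esub> x \<in> span2 u v" using ab c by (simp add: span2I)
qed

lemma span2_memb:
  assumes "u \<in> carrier M" "v \<in> carrier M"
  shows "u \<in> span2 u v" "v \<in> span2 u v"
  using span2I[of \<one> \<zero> u v] span2I[of \<zero> \<one> u v] assms by auto

lemma card_span2:
  assumes uv: "u \<in> carrier M" "v \<in> carrier M" "indep u v"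
  shows "card (span2 u v) = card (carrier R) ^ 2"
proof -
  have "inj_on (\<lambda>(a, b). a \<odot>\<^bsub>M\<^esub> u \<oplus>\<^bsub>M\<^esub> b \<odot>\<^bsub>M\<^esub> v) (carrier R \<times> carrier R)"
  proof (rule inj_onI, clarify)
    fix a b c d assume ab: "a \<in> carrier R" "b \<in> carrier R" "c \<in> carrier R" "d \<in> carrier R"
      and eq: "a \<odot>\<^bsub>M\<^esub> u \<oplus>\<^bsub>M\<^esub> b \<odot>\<^bsub>M\<^esub> v = c \<odot>\<^bsub>M\<^esub> u \<oplus>\<^bsub>M\<^esub> d \<odot>\<^bsub>M\<^esub> v"
    have "(a \<ominus> c) \<odot>\<^bsub>M\<^esub> u \<oplus>\<^bsub>M\<^esub> (b \<ominus> d) \<odot>\<^bsub>M\<^esub> v =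
      (a \<odot>\<^bsub>M\<^esub> u \<oplus>\<^bsub>M\<^esub> b \<odot>\<^bsub>M\<^esub> v) \<oplus>\<^bsub>M\<^esub> (\<ominus>\<^bsub>M\<^esub> (c \<odot>\<^bsub>M\<^esub> u \<oplus>\<^bsub>M\<^esub> d \<odot>\<^bsub>M\<^esub> v))"
      using ab uv by (simp add: smult_diff M.minus_add M.a_ac)
    also have "\<dots> = \<zero>\<^bsub>M\<^esub>" unfolding eq using ab uv by (simp add: M.r_neg)
    finally have "a \<ominus> c = \<zero> \<and> b \<ominus> d = \<zero>"
      using uv(3) ab R.minus_closed unfolding indep_def by blast
    then show "a = c \<and> b = d" using ab by simp_all
  qed
  then show ?thesis
    unfolding span2_def by (simp add: card_image card_cartesian_product power2_eq_square)
qed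

lemma card_scalars: "card (carrier R) \<ge> 2"
proof -
  have "card {\<zero>, \<one>} \<le> card (carrier R)"
    using finite_scalars by (intro card_mono) auto
  then show ?thesis by simp
qed

text \<open>The points on \<open>W\<close> partition its nonzero vectors into blocks of
  \<open>q - 1\<close>, where \<open>q\<close> is the number of scalars. The product form avoids
  division.\<close>

lemma card_pts_of:
  assumes W: "subsp W"
  shows "card (pts_of W) * (card (carrier R) - 1) = card W - 1"
proof -
  have finW: "finite W" using W finite_vectors finite_subset by (auto simp: subsp_def)
  have repr: "\<exists>u. u \<in> carrier M \<and> u \<noteq> \<zero>\<^bsub>M\<^esub> \<and> P = pt u" if "P \<in> pts_of W" for P
    using that by (auto simp: pts_of_def pts_def)
  have zero: "\<zero>\<^bsub>M\<^esub> \<in> pt u" if "u \<in> carrier M" for u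
    unfolding pt_def using that by (intro image_eqI[of _ _ \<zero>]) auto
  have finP: "finite P" if "P \<in> pts_of W" for P
    using that finW finite_subset by (auto simp: pts_of_def)
  have fin: "finite (pts_of W)"
    using finW by (intro finite_subset[of "pts_of W" "Pow W"]) (auto simp: pts_of_def)
  have "W - {\<zero>\<^bsub>M\<^esub>} = (\<Union>P\<in>pts_of W. P - {\<zero>\<^bsub>M\<^esub>})"
  proof (intro equalityI subsetI)
    fix u assume u: "u \<in> W - {\<zero>\<^bsub>M\<^esub>}"
    then have "u \<in> carrier M" using W by (auto simp: subsp_def)
    then have "pt u \<in> pts_of W" "u \<in> pt u"
      using u W pt_subset self_in_pt by (auto simp: pts_of_def pts_def)
    then show "u \<in> (\<Union>P\<in>pts_of W. P - {\<zero>\<^bsub>M\<^esub>})" using u by auto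
  qed (auto simp: pts_of_def)
  then have "card (W - {\<zero>\<^bsub>M\<^esub>}) = card (\<Union>P\<in>pts_of W. P - {\<zero>\<^bsub>M\<^esub>})" by simp
  also have "\<dots> = (\<Sum>P\<in>pts_of W. card (P - {\<zero>\<^bsub>M\<^esub>}))"
  proof (rule card_UN_disjoint[OF fin])
    show "\<forall>P\<in>pts_of W. finite (P - {\<zero>\<^bsub>M\<^esub>})" using finP by simp
    show "\<forall>P\<in>pts_of W. \<forall>Q\<in>pts_of W. P \<noteq> Q \<longrightarrow> (P - {\<zero>\<^bsub>M\<^esub>}) \<inter> (Q - {\<zero>\<^bsub>M\<^esub>}) = {}"
    proof (intro ballI impI)
      fix P Q assume PQ: "P \<in> pts_of W" "Q \<in> pts_of W" "P \<noteq> Q"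
      then obtain u v where "u \<in> carrier M" "v \<in> carrier M" "P = pt u" "Q = pt v"
        using repr by meson
      then show "(P - {\<zero>\<^bsub>M\<^esub>}) \<inter> (Q - {\<zero>\<^bsub>M\<^esub>}) = {}"
        using pt_eq[of u] pt_eq[of v] PQ(3) by blast
    qed
  qed
  also have "\<dots> = (\<Sum>P\<in>pts_of W. card (carrier R) - 1)"
  proof (rule sum.cong[OF refl])
    fix P assume P: "P \<in> pts_of W"
    then obtain u where u: "u \<in> carrier M" "u \<noteq> \<zero>\<^bsub>M\<^esub>" "P = pt u" using repr by meson
    then show "card (P - {\<zero>\<^bsub>M\<^esub>}) = card (carrier R) - 1"
      using card_pt[OF u(1,2)] zero[OF u(1)] finP[OF P] by simp
  qed
  finally show ?thesis using W finW by (simp add: subsp_def)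
qed

text \<open>If the coefficient of \<open>v\<close> were nonzero, a nonzero multiple of
  \<open>v\<close> would lie in \<open>pt u\<close> and the two points would coincide.\<close>

lemma indepI:
  assumes u: "u \<in> carrier M" "u \<noteq> \<zero>\<^bsub>M\<^esub>" and v: "v \<in> carrier M" "v \<noteq> \<zero>\<^bsub>M\<^esub>" and ne: "pt u \<noteq> pt v"
  shows "indep u v"
  unfolding indep_def
proof (intro ballI impI)
  fix a b assume ab: "a \<in> carrier R" "b \<in> carrier R"
    and eq: "a \<odot>\<^bsub>M\<^esub> u \<oplus>\<^bsub>M\<^esub> b \<odot>\<^bsub>M\<^esub> v = \<zero>\<^bsub>M\<^esub>"
  have b0: "b = \<zero>"
  proof (rule ccontr)
    assume b: "b \<noteq> \<zero>"
    have "b \<odot>\<^bsub>M\<^esub> v = \<ominus>\<^bsub>M\<^esub> (a \<odot>\<^bsub>M\<^esub> u)"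
      using eq ab u v M.minus_equality[of "b \<odot>\<^bsub>M\<^esub> v" "a \<odot>\<^bsub>M\<^esub> u"] by (simp add: M.a_comm)
    also have "\<dots> = (\<ominus> a) \<odot>\<^bsub>M\<^esub> u" using ab u by (simp add: smult_l_minus)
    finally have "b \<odot>\<^bsub>M\<^esub> v \<in> pt u" using ab by (auto simp: pt_def)
    moreover have "b \<odot>\<^bsub>M\<^esub> v \<noteq> \<zero>\<^bsub>M\<^esub>" using smult_eq_zero ab v b by auto
    ultimately have "pt (b \<odot>\<^bsub>M\<^esub> v) = pt u" using pt_eq u by auto
    moreover have "pt (b \<odot>\<^bsub>M\<^esub> v) = pt v"
      using pt_eq[OF v(1)] \<open>b \<odot>\<^bsub>M\<^esub> v \<noteq> \<zero>\<^bsub>M\<^esub>\<close> ab by (auto simp: pt_def)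
    ultimately show False using ne by simp
  qed
  then have "a \<odot>\<^bsub>M\<^esub> u = \<zero>\<^bsub>M\<^esub>" using eq ab u v by simp
  then show "a = \<zero> \<and> b = \<zero>" using b0 smult_eq_zero ab u by auto
qed

text \<open>Counting replaces an exchange argument: the span lies in \<open>L\<close>, and both have
  \<open>q^2\<close> vectors, \<open>q\<close> being the number of scalars.\<close>

lemma two_dim_eq_span2:
  assumes L: "L \<in> two_dim" and uv: "indep u v" "u \<in> L" "v \<in> L"
  shows "L = span2 u v"
proof -
  obtain x y where xy: "x \<in> carrier M" "y \<in> carrier M" "indep x y" "L = span2 x y"
    using L by (auto simp: two_dim_def)
  have cl: "subsp L" using subsp_span2 xy by simp
  then have uvM: "u \<in> carrier M" "v \<in> carrier M" using uv by (auto simp: subsp_def)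
  have "span2 u v \<subseteq> L" using cl uv by (auto simp: span2_def subsp_def)
  moreover have "card (span2 u v) = card L" using card_span2 xy uvM uv by simp
  moreover have "finite L" using cl finite_vectors finite_subset by (auto simp: subsp_def)
  ultimately show ?thesis using card_subset_eq by metis
qed

lemma subsp_two_dim: "L \<in> two_dim \<Longrightarrow> subsp L"
  using subsp_span2 by (auto simp: two_dim_def)

lemma pt_in_pts_of:
  assumes "subsp W" "u \<in> carrier M" "u \<noteq> \<zero>\<^bsub>M\<^esub>"
  shows "pt u \<in> pts_of W \<longleftrightarrow> u \<in> W"
  using assms pt_subset by (auto simp: pts_of_def pts_def)

lemma ptsE:
  assumes "P \<in> pts_of W"
  obtains u where "u \<in> carrier M" "u \<noteq> \<zero>\<^bsub>M\<^esub>" "P = pt u"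
  using assms by (auto simp: pts_of_def pts_def)

text \<open>Let \<open>x\<close> and \<open>y\<close> represent the points where \<open>L\<close>
  meets the first two sides. Eliminating the vector \<open>v\<close> of the common vertex from them
  leaves a vector of \<open>L\<close> in the span of \<open>u\<close> and \<open>w\<close>, the
  third side.\<close>

lemma veblen_pts:
  assumes pl: "L \<in> two_dim" "M1 \<in> two_dim" "M2 \<in> two_dim" "M3 \<in> two_dim"
    and ne: "P \<noteq> Q" "Q \<noteq> S" "P \<noteq> S"
    and inc: "P \<in> pts_of M1" "Q \<in> pts_of M1" "Q \<in> pts_of M2" "S \<in> pts_of M2"
      "P \<in> pts_of M3" "S \<in> pts_of M3" "Q \<notin> pts_of L"
    and meet: "pts_of L \<inter> pts_of M1 \<noteq> {}" "pts_of L \<inter> pts_of M2 \<noteq> {}"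
  shows "pts_of L \<inter> pts_of M3 \<noteq> {}"
proof -
  obtain u where u: "u \<in> carrier M" "u \<noteq> \<zero>\<^bsub>M\<^esub>" "P = pt u" using ptsE inc(1) by blast
  obtain v where v: "v \<in> carrier M" "v \<noteq> \<zero>\<^bsub>M\<^esub>" "Q = pt v" using ptsE inc(2) by blast
  obtain w where w: "w \<in> carrier M" "w \<noteq> \<zero>\<^bsub>M\<^esub>" "S = pt w" using ptsE inc(4) by blast
  obtain X where X: "X \<in> pts_of L" "X \<in> pts_of M1" using meet(1) by blast
  obtain x where x: "x \<in> carrier M" "x \<noteq> \<zero>\<^bsub>M\<^esub>" "X = pt x" using ptsE X(1) by blast
  obtain Y where Y: "Y \<in> pts_of L" "Y \<in> pts_of M2" using meet(2) by blast
  obtain y where y: "y \<in> carrier M" "y \<noteq> \<zero>\<^bsub>M\<^esub>" "Y = pt y" using ptsE Y(1) by blast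
  note cl = pl[THEN subsp_two_dim]
  have mem: "u \<in> M1" "v \<in> M1" "v \<in> M2" "w \<in> M2" "u \<in> M3" "w \<in> M3" "v \<notin> L"
    "x \<in> L" "x \<in> M1" "y \<in> L" "y \<in> M2"
    using inc X Y unfolding u(3) v(3) w(3) x(3) y(3)
    by (simp_all only: pt_in_pts_of[OF _ u(1,2)] pt_in_pts_of[OF _ v(1,2)] pt_in_pts_of[OF _ w(1,2)]
        pt_in_pts_of[OF _ x(1,2)] pt_in_pts_of[OF _ y(1,2)] cl simp_thms)
  have uv: "indep u v" and vw: "indep v w" and uw: "indep u w"
    using indepI u v w ne by auto
  obtain a b where ab: "a \<in> carrier R" "b \<in> carrier R" "x = a \<odot>\<^bsub>M\<^esub> u \<oplus>\<^bsub>M\<^esub> b \<odot>\<^bsub>M\<^esub> v"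
    using mem(9) unfolding two_dim_eq_span2[OF pl(2) uv mem(1,2)] by (rule span2E)
  obtain c d where cd: "c \<in> carrier R" "d \<in> carrier R" "y = c \<odot>\<^bsub>M\<^esub> v \<oplus>\<^bsub>M\<^esub> d \<odot>\<^bsub>M\<^esub> w"
    using mem(11) unfolding two_dim_eq_span2[OF pl(3) vw mem(3,4)] by (rule span2E)
  \<comment> \<open>No nonzero vector of \<open>L\<close> represents \<open>Q\<close>, so
    \<open>x\<close> has a component along \<open>u\<close> and \<open>y\<close> one along
    \<open>w\<close>.\<close>
  have not_v: "z \<notin> pt v" if "z \<in> L" "z \<noteq> \<zero>\<^bsub>M\<^esub>" for z
  proof
    assume "z \<in> pt v"
    then have "pt z = pt v" using pt_eq v(1) that(2) by blast
    then have "v \<in> pt z" using self_in_pt[OF v(1)] by simp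
    moreover have "z \<in> carrier M" using cl(1) that(1) by (auto simp: subsp_def)
    ultimately show False using pt_subset[OF cl(1), of z] that(1) mem(7) by blast
  qed
  have a0: "a \<noteq> \<zero>"
  proof
    assume "a = \<zero>"
    then have "x = b \<odot>\<^bsub>M\<^esub> v" using ab u(1) v(1) by simp
    then show False using not_v[OF mem(8) x(2)] ab(2) by (simp add: pt_def)
  qed
  have d0: "d \<noteq> \<zero>"
  proof
    assume "d = \<zero>"
    then have "y = c \<odot>\<^bsub>M\<^esub> v" using cd w(1) v(1) by simp
    then show False using not_v[OF mem(10) y(2)] cd(1) by (simp add: pt_def)
  qed
  \<comment> \<open>The coefficients are chosen to cancel \<open>v\<close>: it occurs with
    \<open>b\<close> in \<open>x\<close> and with \<open>c\<close> in \<open>y\<close>.\<close>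
  define z where "z = c \<odot>\<^bsub>M\<^esub> x \<oplus>\<^bsub>M\<^esub> (\<ominus> b) \<odot>\<^bsub>M\<^esub> y"
  have zL: "z \<in> L" unfolding z_def using cl(1) mem(8,10) ab cd by (auto simp: subsp_def)
  have "z = (c \<otimes> a) \<odot>\<^bsub>M\<^esub> u \<oplus>\<^bsub>M\<^esub> ((c \<otimes> b \<oplus> (\<ominus> b) \<otimes> c) \<odot>\<^bsub>M\<^esub> v \<oplus>\<^bsub>M\<^esub> ((\<ominus> b) \<otimes> d) \<odot>\<^bsub>M\<^esub> w)"
    unfolding z_def ab(3) cd(3) using ab(1,2) cd(1,2) u v w
    by (simp add: smult_r_distr smult_l_distr smult_assoc1 M.a_assoc)
  also have "c \<otimes> b \<oplus> (\<ominus> b) \<otimes> c = \<zero>"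
    using ab cd by (simp add: R.l_minus R.m_comm[of c b] R.r_neg)
  finally have z: "z = (c \<otimes> a) \<odot>\<^bsub>M\<^esub> u \<oplus>\<^bsub>M\<^esub> ((\<ominus> b) \<otimes> d) \<odot>\<^bsub>M\<^esub> w"
    using ab cd u v w by simp
  have M3: "M3 = span2 u w" using two_dim_eq_span2 pl(4) uw mem by blast
  show ?thesis
  proof (cases "z = \<zero>\<^bsub>M\<^esub>")
    case True
    \<comment> \<open>A zero combination forces \<open>b = \<zero>\<close>, because \<open>d\<close>
      is nonzero; then \<open>x\<close> is a multiple of \<open>u\<close> and \<open>P\<close>
      itself lies on \<open>L\<close>.\<close>
    then have "(\<ominus> b) \<otimes> d = \<zero>"
      using uw ab(1,2) cd(1,2) R.m_closed R.a_inv_closed unfolding z indep_def by blast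
    then have "\<ominus> b = \<zero>" using R.integral[of "\<ominus> b" d] ab cd d0 by auto
    then have "b = \<zero>" using R.minus_minus[of b] ab by simp
    then have "x = a \<odot>\<^bsub>M\<^esub> u" using ab u(1) v(1) by simp
    then have "x \<in> pt u" using ab(1) by (simp add: pt_def)
    then have "X = P" using pt_eq[OF u(1) _ x(2)] u(3) x(3) by simp
    then show ?thesis using X(1) inc(5) by blast
  next
    case False
    have "z \<in> M3" unfolding M3 z using ab cd by (intro span2I) auto
    then have "pt z \<in> pts_of L" "pt z \<in> pts_of M3"
      using zL False pt_in_pts_of[OF cl(1), of z] pt_in_pts_of[OF cl(4), of z] cl(1)
      by (auto simp: subsp_def)
    then show ?thesis by blast
  qed
qed

text \<open>The hypothesis \<open>dim\<close> enters through the number of points; incidence comes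
  from spans of two vectors.\<close>

lemma projective_space_pts:
  assumes dim: "card (carrier M) = card (carrier R) ^ 4"
  shows "projective_space pts (pts_of ` two_dim) (card (carrier R))"
proof
  let ?q = "card (carrier R)"
  \<comment> \<open>Writing the order as \<open>Suc (Suc k)\<close> removes truncated subtraction
    from the polynomial identities and lets the order minus one be cancelled.\<close>
  obtain k where k: "?q = Suc (Suc k)" using card_scalars by (metis add_2_eq_Suc le_Suc_ex)
  have nz: "?q - 1 \<noteq> 0" using k by simp
  show "?q > 0" using k by simp
  show "L \<subseteq> pts" if "L \<in> pts_of ` two_dim" for L using that by (auto simp: pts_of_def)
  show "card L = ?q + 1" if L: "L \<in> pts_of ` two_dim" for L
  proof -
    obtain W where W: "W \<in> two_dim" "L = pts_of W" using L by auto
    have "card W = ?q ^ 2" using W(1) card_span2 by (auto simp: two_dim_def)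
    then have "card L * (?q - 1) = ?q ^ 2 - 1" using card_pts_of[OF subsp_two_dim[OF W(1)]] W by simp
    also have "\<dots> = (?q + 1) * (?q - 1)" unfolding k by (simp add: power2_eq_square)
    finally show ?thesis by (rule mult_right_cancel[OF nz, THEN iffD1])
  qed
  show "card pts = ?q ^ 3 + ?q ^ 2 + ?q + 1"
  proof -
    have "pts = pts_of (carrier M)"
      using subsp_carrier pt_subset by (auto simp: pts_of_def pts_def)
    then have "card pts * (?q - 1) = ?q ^ 4 - 1"
      using card_pts_of[OF subsp_carrier] dim by simp
    also have "\<dots> = (?q ^ 3 + ?q ^ 2 + ?q + 1) * (?q - 1)"
      unfolding k by (simp add: power2_eq_square power3_eq_cube power4_eq_xxxx algebra_simps)
    finally show ?thesis by (rule mult_right_cancel[OF nz, THEN iffD1])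
  qed
  show "\<exists>L\<in>pts_of ` two_dim. P \<in> L \<and> Q \<in> L" if PQ: "P \<in> pts" "Q \<in> pts" "P \<noteq> Q" for P Q
  proof -
    obtain u v where uv: "u \<in> carrier M" "u \<noteq> \<zero>\<^bsub>M\<^esub>" "P = pt u" "v \<in> carrier M" "v \<noteq> \<zero>\<^bsub>M\<^esub>" "Q = pt v"
      using PQ by (auto simp: pts_def)
    then have "span2 u v \<in> two_dim" using indepI PQ(3) by (auto simp: two_dim_def)
    moreover have "P \<in> pts_of (span2 u v)" "Q \<in> pts_of (span2 u v)"
      using uv pt_in_pts_of subsp_span2 span2_memb by auto
    ultimately show ?thesis by blast
  qed
  show "L = L'" if L: "L \<in> pts_of ` two_dim" "L' \<in> pts_of ` two_dim" and PQ: "P \<noteq> Q"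
    "P \<in> L" "Q \<in> L" "P \<in> L'" "Q \<in> L'" for L L' P Q
  proof -
    obtain W W' where W: "W \<in> two_dim" "L = pts_of W" "W' \<in> two_dim" "L' = pts_of W'"
      using L by auto
    obtain u where u: "u \<in> carrier M" "u \<noteq> \<zero>\<^bsub>M\<^esub>" "P = pt u" using ptsE PQ(2) W(2) by blast
    obtain v where v: "v \<in> carrier M" "v \<noteq> \<zero>\<^bsub>M\<^esub>" "Q = pt v" using ptsE PQ(3) W(2) by blast
    have "indep u v" using indepI u v PQ(1) by auto
    moreover have "u \<in> W" "v \<in> W" "u \<in> W'" "v \<in> W'"
      using pt_in_pts_of subsp_two_dim W u v PQ by auto
    ultimately show ?thesis using two_dim_eq_span2 W by metis
  qed
  show "L \<inter> M3 \<noteq> {}"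
    if "L \<in> pts_of ` two_dim" "M1 \<in> pts_of ` two_dim" "M2 \<in> pts_of ` two_dim" "M3 \<in> pts_of ` two_dim"
      "P \<noteq> Q" "Q \<noteq> S" "P \<noteq> S" "P \<in> M1" "Q \<in> M1" "Q \<in> M2" "S \<in> M2" "P \<in> M3" "S \<in> M3"
      "Q \<notin> L" "L \<inter> M1 \<noteq> {}" "L \<inter> M2 \<noteq> {}" for L M1 M2 M3 P Q S
    using that veblen_pts[of _ _ _ _ P Q S] by (elim imageE) simp
qed

end

section \<open>Coordinate vectors as a module\<close>

text \<open>The record of modules extends that of rings, but the module axioms leave its
  multiplication and unit open, so these fields are filled arbitrarily. Restricting results to
  \<open>{..<n}\<close> keeps vectors extensional.\<close>

definition vec_module :: "('a, 'm) ring_scheme \<Rightarrow> nat \<Rightarrow> ('a, nat \<Rightarrow> 'a) module" where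
  "vec_module F n = \<lparr>carrier = vectors F n, mult = undefined, one = undefined,
    zero = zero_vector F n, add = \<lambda>u v. \<lambda>i\<in>{..<n}. u i \<oplus>\<^bsub>F\<^esub> v i,
    smult = \<lambda>a v. \<lambda>i\<in>{..<n}. a \<otimes>\<^bsub>F\<^esub> v i\<rparr>"

lemma vec_module_simps:
  "carrier (vec_module F n) = vectors F n"
  "zero (vec_module F n) = zero_vector F n"
  "add (vec_module F n) u v = (\<lambda>i\<in>{..<n}. u i \<oplus>\<^bsub>F\<^esub> v i)"
  "smult (vec_module F n) a v = (\<lambda>i\<in>{..<n}. a \<otimes>\<^bsub>F\<^esub> v i)"
  by (simp_all add: vec_module_def)

lemma vectors_nth: "v \<in> vectors F n \<Longrightarrow> i < n \<Longrightarrow> v i \<in> carrier F"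
  by (auto simp: vectors_def)

lemma vectors_eqI:
  assumes "u \<in> vectors F n" "v \<in> vectors F n" "\<And>i. i < n \<Longrightarrow> u i = v i"
  shows "u = v"
  using assms unfolding vectors_def by (intro PiE_ext) auto

lemma module_vec_module:
  assumes "field F"
  shows "module F (vec_module F n)"
proof -
  interpret field F by (rule assms)
  have fam: "(\<lambda>i\<in>{..<n}. f i) \<in> vectors F n" if "\<And>i. i < n \<Longrightarrow> f i \<in> carrier F" for f
    using that by (auto simp: vectors_def)
  note nth = vectors_nth[of _ F n]
  have group: "abelian_group (vec_module F n)"
  proof (rule abelian_groupI, unfold vec_module_simps)
    show "zero_vector F n \<in> vectors F n"
      unfolding zero_vector_def by (rule fam) simp
  next
    fix x y assume "x \<in> vectors F n" "y \<in> vectors F n"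
    then show "(\<lambda>i\<in>{..<n}. x i \<oplus>\<^bsub>F\<^esub> y i) \<in> vectors F n"
      by (intro fam) (simp add: nth)
    show "(\<lambda>i\<in>{..<n}. x i \<oplus>\<^bsub>F\<^esub> y i) = (\<lambda>i\<in>{..<n}. y i \<oplus>\<^bsub>F\<^esub> x i)"
      using nth \<open>x \<in> _\<close> \<open>y \<in> _\<close> by (intro restrict_ext) (simp add: a_comm)
  next
    fix x y z assume "x \<in> vectors F n" "y \<in> vectors F n" "z \<in> vectors F n"
    then show "(\<lambda>i\<in>{..<n}. (\<lambda>i\<in>{..<n}. x i \<oplus>\<^bsub>F\<^esub> y i) i \<oplus>\<^bsub>F\<^esub> z i) =
      (\<lambda>i\<in>{..<n}. x i \<oplus>\<^bsub>F\<^esub> (\<lambda>i\<in>{..<n}. y i \<oplus>\<^bsub>F\<^esub> z i) i)"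
      by (intro restrict_ext) (simp add: a_assoc nth)
  next
    fix x assume x: "x \<in> vectors F n"
    show "(\<lambda>i\<in>{..<n}. zero_vector F n i \<oplus>\<^bsub>F\<^esub> x i) = x"
    proof (rule vectors_eqI[OF _ x])
      show "(\<lambda>i\<in>{..<n}. zero_vector F n i \<oplus>\<^bsub>F\<^esub> x i) \<in> vectors F n"
        using nth[OF x] by (intro fam) (simp add: zero_vector_def)
    qed (use nth[OF x] in \<open>simp add: zero_vector_def\<close>)
    show "\<exists>y\<in>vectors F n. (\<lambda>i\<in>{..<n}. y i \<oplus>\<^bsub>F\<^esub> x i) = zero_vector F n"
    proof (rule bexI)
      show "(\<lambda>i\<in>{..<n}. \<ominus>\<^bsub>F\<^esub> x i) \<in> vectors F n"
        using nth[OF x] by (intro fam) simp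
      show "(\<lambda>i\<in>{..<n}. (\<lambda>i\<in>{..<n}. \<ominus>\<^bsub>F\<^esub> x i) i \<oplus>\<^bsub>F\<^esub> x i) = zero_vector F n"
        unfolding zero_vector_def using nth[OF x] by (intro restrict_ext) (simp add: l_neg)
    qed
  qed
  show ?thesis
  proof (rule moduleI[OF is_cring group], unfold vec_module_simps)
    fix x assume x: "x \<in> vectors F n"
    show "(\<lambda>i\<in>{..<n}. \<one>\<^bsub>F\<^esub> \<otimes>\<^bsub>F\<^esub> x i) = x"
    proof (rule vectors_eqI[OF _ x])
      show "(\<lambda>i\<in>{..<n}. \<one>\<^bsub>F\<^esub> \<otimes>\<^bsub>F\<^esub> x i) \<in> vectors F n"
        using nth[OF x] by (intro fam) simp
    qed (use nth[OF x] in simp)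
  qed (rule fam restrict_ext; simp add: nth l_distr r_distr m_assoc)+
qed

section \<open>Agreement of the coordinate definitions with points and lines of the module\<close>

lemma lin_comb_1:
  assumes "field F" "a \<in> {..<1} \<rightarrow> carrier F" "v \<in> {..<1} \<rightarrow> vectors F n"
  shows "lin_comb F n 1 a v = smult (vec_module F n) (a 0) (v 0)"
proof -
  interpret field F by (rule assms)
  have "(\<Oplus>\<^bsub>F\<^esub>j\<in>{..<1}. a j \<otimes>\<^bsub>F\<^esub> v j i) = a 0 \<otimes>\<^bsub>F\<^esub> v 0 i" if "i < n" for i
    using assms that vectors_nth[of "v 0" F n i] by (simp add: lessThan_Suc Pi_def)
  then show ?thesis by (auto simp: lin_comb_def vec_module_simps)
qed

lemma lin_comb_2:
  assumes "field F" "a \<in> {..<2} \<rightarrow> carrier F" "v \<in> {..<2} \<rightarrow> vectors F n"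
  shows "lin_comb F n 2 a v =
    add (vec_module F n) (smult (vec_module F n) (a 0) (v 0)) (smult (vec_module F n) (a 1) (v 1))"
proof -
  interpret field F by (rule assms)
  have "(\<Oplus>\<^bsub>F\<^esub>j\<in>{..<2}. a j \<otimes>\<^bsub>F\<^esub> v j i) = a 0 \<otimes>\<^bsub>F\<^esub> v 0 i \<oplus>\<^bsub>F\<^esub> a 1 \<otimes>\<^bsub>F\<^esub> v 1 i"
    if "i < n" for i
  proof -
    have "a 0 \<in> carrier F" "a 1 \<in> carrier F" "v 0 i \<in> carrier F" "v 1 i \<in> carrier F"
      using assms that by (auto intro: vectors_nth)
    then show ?thesis
      by (simp add: numeral_2_eq_2 lessThan_Suc a_comm)
  qed
  then show ?thesis by (auto simp: lin_comb_def vec_module_simps)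
qed

lemma finite_vector_space_vec_module:
  assumes "field F" "finite (carrier F)"
  shows "finite_vector_space F (vec_module F n)"
proof (intro finite_vector_space.intro finite_vector_space_axioms.intro module_vec_module assms)
  show "finite (carrier (vec_module F n))"
    using assms(2) by (simp add: vec_module_simps vectors_def finite_PiE)
qed

context
  fixes F :: "('a, 'm) ring_scheme" and n :: nat
  assumes F: "field F" and fin: "finite (carrier F)"
begin

interpretation V: finite_vector_space F "vec_module F n"
  by (rule finite_vector_space_vec_module[OF F fin])

lemma lin_span_1:
  assumes v: "v \<in> {..<1} \<rightarrow> vectors F n"
  shows "lin_span F n 1 v = V.pt (v 0)"
proof (intro equalityI subsetI)
  fix x assume "x \<in> lin_span F n 1 v"
  then obtain a where a: "a \<in> {..<1} \<rightarrow> carrier F" "x = lin_comb F n 1 a v"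
    by (auto simp: lin_span_def)
  then show "x \<in> V.pt (v 0)" using lin_comb_1[OF F a(1) v] by (auto simp: V.pt_def)
next
  fix x assume "x \<in> V.pt (v 0)"
  then obtain a where a: "a \<in> carrier F" "x = smult (vec_module F n) a (v 0)"
    by (auto simp: V.pt_def)
  then show "x \<in> lin_span F n 1 v"
    unfolding lin_span_def using lin_comb_1[OF F _ v, of "\<lambda>_. a"]
    by (intro CollectI exI[of _ "\<lambda>_. a"]) auto
qed

lemma lin_span_2:
  assumes v: "v \<in> {..<2} \<rightarrow> vectors F n"
  shows "lin_span F n 2 v = V.span2 (v 0) (v 1)"
proof (intro equalityI subsetI)
  fix x assume "x \<in> lin_span F n 2 v"
  then obtain a where a: "a \<in> {..<2} \<rightarrow> carrier F" "x = lin_comb F n 2 a v"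
    by (auto simp: lin_span_def)
  then show "x \<in> V.span2 (v 0) (v 1)" using lin_comb_2[OF F a(1) v] by (auto intro!: V.span2I)
next
  fix x assume "x \<in> V.span2 (v 0) (v 1)"
  then obtain a b where "a \<in> carrier F" "b \<in> carrier F"
    "x = add (vec_module F n) (smult (vec_module F n) a (v 0)) (smult (vec_module F n) b (v 1))"
    by (rule V.span2E)
  then show "x \<in> lin_span F n 2 v"
    unfolding lin_span_def using lin_comb_2[OF F _ v, of "\<lambda>i. if i = 0 then a else b"]
    by (intro CollectI exI[of _ "\<lambda>i. if i = 0 then a else b"]) auto
qed

lemma lin_indep_1:
  assumes v: "v \<in> {..<1} \<rightarrow> vectors F n"
  shows "lin_indep F n 1 v \<longleftrightarrow> v 0 \<noteq> zero_vector F n"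
proof
  assume ind: "lin_indep F n 1 v"
  have v0: "v 0 \<in> carrier (vec_module F n)" using v by (auto simp: vec_module_simps)
  show "v 0 \<noteq> zero_vector F n"
  proof
    assume "v 0 = zero_vector F n"
    then have "lin_comb F n 1 (\<lambda>_. \<one>\<^bsub>F\<^esub>) v = zero_vector F n"
      using lin_comb_1[OF F _ v, of "\<lambda>_. \<one>\<^bsub>F\<^esub>"] V.smult_one[OF v0] by simp
    then show False using ind by (auto simp: lin_indep_def)
  qed
next
  assume nz: "v 0 \<noteq> zero_vector F n"
  have v0: "v 0 \<in> carrier (vec_module F n)" using v by (auto simp: vec_module_simps)
  show "lin_indep F n 1 v"
    unfolding lin_indep_def
  proof (intro ballI impI allI)
    fix a and j :: nat assume a: "a \<in> {..<1} \<rightarrow> carrier F" "lin_comb F n 1 a v = zero_vector F n" "j < 1"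
    then show "a j = \<zero>\<^bsub>F\<^esub>"
      using V.smult_eq_zero[OF _ v0, of "a 0"] lin_comb_1[OF F a(1) v] nz
      by (auto simp: vec_module_simps(2))
  qed
qed

lemma lin_indep_2:
  assumes v: "v \<in> {..<2} \<rightarrow> vectors F n"
  shows "lin_indep F n 2 v \<longleftrightarrow> V.indep (v 0) (v 1)"
proof
  assume ind: "lin_indep F n 2 v"
  show "V.indep (v 0) (v 1)"
    unfolding V.indep_def
  proof (intro ballI impI)
    fix a b assume ab: "a \<in> carrier F" "b \<in> carrier F"
      and "add (vec_module F n) (smult (vec_module F n) a (v 0)) (smult (vec_module F n) b (v 1)) =
        zero (vec_module F n)"
    then have "lin_comb F n 2 (\<lambda>i. if i = 0 then a else b) v = zero_vector F n"
      using lin_comb_2[OF F _ v, of "\<lambda>i. if i = 0 then a else b"] by (simp add: vec_module_simps(2))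
    then have "\<forall>j<2::nat. (if j = 0 then a else b) = \<zero>\<^bsub>F\<^esub>"
      using ind ab unfolding lin_indep_def
      by (elim ballE[of _ _ "\<lambda>i. if i = 0 then a else b"]) auto
    from this[rule_format, of 0] this[rule_format, of 1] show "a = \<zero>\<^bsub>F\<^esub> \<and> b = \<zero>\<^bsub>F\<^esub>" by simp
  qed
next
  assume ind: "V.indep (v 0) (v 1)"
  show "lin_indep F n 2 v"
    unfolding lin_indep_def
  proof (intro ballI impI allI)
    fix a and j :: nat assume a: "a \<in> {..<2} \<rightarrow> carrier F" "lin_comb F n 2 a v = zero_vector F n" "j < 2"
    have "a 0 \<in> carrier F" "a 1 \<in> carrier F" using a(1) by auto
    then have "a 0 = \<zero>\<^bsub>F\<^esub> \<and> a 1 = \<zero>\<^bsub>F\<^esub>"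
      using ind a(2) unfolding lin_comb_2[OF F a(1) v] V.indep_def vec_module_simps(2) by blast
    moreover have "j = 0 \<or> j = 1" using a(3) by auto
    ultimately show "a j = \<zero>\<^bsub>F\<^esub>" by auto
  qed
qed

lemma subspaces_dim_1: "subspaces_dim F n 1 = V.pts"
proof (intro equalityI subsetI)
  fix P assume "P \<in> subspaces_dim F n 1"
  then obtain v where v: "v \<in> {..<1} \<rightarrow> vectors F n" "lin_indep F n 1 v" "P = lin_span F n 1 v"
    by (auto simp: subspaces_dim_def)
  then have "v 0 \<in> carrier (vec_module F n) - {zero (vec_module F n)}" "P = V.pt (v 0)"
    using lin_indep_1 lin_span_1 by (auto simp: vec_module_simps(1,2))
  then show "P \<in> V.pts" by (simp add: V.pts_def)
next
  fix P assume "P \<in> V.pts"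
  then obtain u where "u \<in> vectors F n" "u \<noteq> zero_vector F n" "P = V.pt u"
    by (auto simp: V.pts_def vec_module_simps(1,2))
  then show "P \<in> subspaces_dim F n 1"
    unfolding subspaces_dim_def using lin_indep_1[of "\<lambda>_. u"] lin_span_1[of "\<lambda>_. u"]
    by (intro CollectI exI[of _ "\<lambda>_. u"]) auto
qed

lemma subspaces_dim_2: "subspaces_dim F n 2 = V.two_dim"
proof (intro equalityI subsetI)
  fix L assume "L \<in> subspaces_dim F n 2"
  then obtain v where v: "v \<in> {..<2} \<rightarrow> vectors F n" "lin_indep F n 2 v" "L = lin_span F n 2 v"
    by (auto simp: subspaces_dim_def)
  then have "v 0 \<in> vectors F n" "v 1 \<in> vectors F n" "V.indep (v 0) (v 1)" "L = V.span2 (v 0) (v 1)"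
    using lin_indep_2 lin_span_2 by auto
  then show "L \<in> V.two_dim" unfolding V.two_dim_def vec_module_simps(1) by blast
next
  fix L assume "L \<in> V.two_dim"
  then obtain u w where "u \<in> vectors F n" "w \<in> vectors F n" "V.indep u w" "L = V.span2 u w"
    unfolding V.two_dim_def vec_module_simps(1) by blast
  then show "L \<in> subspaces_dim F n 2"
    unfolding subspaces_dim_def
    using lin_indep_2[of "\<lambda>i. if i = 0 then u else w"] lin_span_2[of "\<lambda>i. if i = 0 then u else w"]
    by (intro CollectI exI[of _ "\<lambda>i. if i = 0 then u else w"]) auto
qed

end

text \<open>A line, given as a set of vectors, is replaced by the set of points it contains, so that
  incidence becomes membership as \<open>projective_space\<close> demands.\<close>

lemma projective_space_PG3:
  assumes F: "field F" and fin: "finite (carrier F)"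
  shows "projective_space (PG3_points F) ((\<lambda>L. {P \<in> PG3_points F. P \<subseteq> L}) ` PG3_lines F) (order F)"
proof -
  interpret V: finite_vector_space F "vec_module F 4"
    by (rule finite_vector_space_vec_module[OF F fin])
  have "card (carrier (vec_module F 4)) = card (carrier F) ^ 4"
    by (simp add: vec_module_simps vectors_def card_PiE)
  from V.projective_space_pts[OF this] show ?thesis
    unfolding PG3_points_def PG3_lines_def subspaces_dim_1[OF F fin] subspaces_dim_2[OF F fin]
    by (simp add: V.pts_of_def order_def)
qed

theorem theorem3p9:
  shows "\<exists>c::real. c > 0 \<and> (\<exists>q0::nat. \<forall>\<gamma>::real. \<forall>q::nat. \<forall>F :: nat ring.
    0 < \<gamma> \<longrightarrow> \<gamma> \<le> 1 / 10 \<longrightarrow> q \<ge> q0 \<longrightarrow>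
    field F \<longrightarrow> finite (carrier F) \<longrightarrow> order F = q \<longrightarrow>
    (\<exists>\<C> :: (nat \<Rightarrow> nat) set set set.
      (\<forall>C\<in>\<C>. C \<subseteq> fst (PG3_hypergraph F)) \<and>
      (\<forall>I. PG3_cap F I \<longrightarrow> (\<exists>C\<in>\<C>. I \<subseteq> C)) \<and>
      (\<forall>C\<in>\<C>. real (card C) \<le> (1 + \<gamma>) * real (q^2 + q + 1)) \<and>
      ln (real (card \<C>)) \<le> c * real q * (ln (real q))^2 + c * (1 / \<gamma>) * real q * ln (real q)))"
\<comment> \<open>\<open>40\<close> is the constant of \<open>exists_cap_containers\<close> and
  \<open>3\<close> its threshold for \<open>q\<close>.\<close>
proof (intro exI[of _ "40::real"] conjI exI[of _ "3::nat"] allI impI)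
  show "(40::real) > 0" by simp
next
  fix \<gamma> :: real and q :: nat and F :: "nat ring"
  assume \<gamma>: "0 < \<gamma>" and q: "q \<ge> 3" and F: "field F" "finite (carrier F)" and ord: "order F = q"
  interpret P: projective_space "PG3_points F" "(\<lambda>L. {P \<in> PG3_points F. P \<subseteq> L}) ` PG3_lines F" q
    using projective_space_PG3[OF F] unfolding ord .
  obtain \<C> where C: "\<forall>C\<in>\<C>. C \<subseteq> PG3_points F \<and> card C \<le> q^2 + q + 1"
    "\<forall>I. P.cap I \<longrightarrow> (\<exists>C\<in>\<C>. I \<subseteq> C)"
    "ln (real (card \<C>)) \<le> 40 * real q * (ln (real q))\<^sup>2"
    using P.exists_cap_containers[OF q] by blast
  have cap: "P.cap I" if I: "PG3_cap F I" for I
  proof (rule P.capI)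
    show "I \<subseteq> PG3_points F" using I by (simp add: PG3_cap_def)
  next
    fix L T
    assume "L \<in> (\<lambda>L. {P \<in> PG3_points F. P \<subseteq> L}) ` PG3_lines F" "T \<subseteq> L"
    then have "PG3_collinear F T" by (auto simp: PG3_collinear_def)
    moreover assume "T \<subseteq> I" "card T = 3"
    ultimately show False using I by (auto simp: PG3_cap_def)
  qed
  show "\<exists>\<C> :: (nat \<Rightarrow> nat) set set set.
      (\<forall>C\<in>\<C>. C \<subseteq> fst (PG3_hypergraph F)) \<and>
      (\<forall>I. PG3_cap F I \<longrightarrow> (\<exists>C\<in>\<C>. I \<subseteq> C)) \<and>
      (\<forall>C\<in>\<C>. real (card C) \<le> (1 + \<gamma>) * real (q^2 + q + 1)) \<and>
      ln (real (card \<C>)) \<le> 40 * real q * (ln (real q))^2 + 40 * (1 / \<gamma>) * real q * ln (real q)"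
  proof (intro exI[of _ \<C>] conjI ballI allI impI)
    fix C assume "C \<in> \<C>"
    then have "C \<subseteq> PG3_points F" "card C \<le> q^2 + q + 1" using C(1) by auto
    then show "C \<subseteq> fst (PG3_hypergraph F)" by (simp add: PG3_hypergraph_def)
    \<comment> \<open>The containers have at most \<open>q^2 + q + 1\<close> points for every
      \<open>\<gamma>\<close>, so the factor \<open>1 + \<gamma>\<close> only adds slack.\<close>
    have "real (card C) \<le> 1 * real (q^2 + q + 1)"
      using \<open>card C \<le> q^2 + q + 1\<close> unfolding mult_1 by (rule of_nat_mono)
    also have "\<dots> \<le> (1 + \<gamma>) * real (q^2 + q + 1)"
      using \<gamma> by (intro mult_right_mono of_nat_0_le_iff) simp
    finally show "real (card C) \<le> (1 + \<gamma>) * real (q^2 + q + 1)" .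
  next
    fix I assume "PG3_cap F I"
    then show "\<exists>C\<in>\<C>. I \<subseteq> C" using C(2) cap by blast
  next
    \<comment> \<open>The second summand is nonnegative, so the bound by the first suffices.\<close>
    have "0 \<le> 40 * (1 / \<gamma>) * real q * ln (real q)"
      using \<gamma> q by (intro mult_nonneg_nonneg) auto
    then show "ln (real (card \<C>)) \<le> 40 * real q * (ln (real q))^2 + 40 * (1 / \<gamma>) * real q * ln (real q)"
      using C(3) by linarith
  qed
qed

end
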